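(* Let $(A,\cdot_\lambda\cdot)$ be an associative conformal algebra and $r\in A\otimes A$. Suppose that $r$ is antisymmetric. Then the map $\Delta:A\to A\otimes A$ defined by $$\Delta(a)=(I\otimes L_A(a)_\lambda-R_A(a)_\lambda\otimes I)r\big|_{\lambda=-\partial^{\otimes^2}},\qquad\forall\ a\in A,$$ gives an associative conformal coalgebra $(A,\Delta)$ such that $(A,\cdot_\lambda\cdot,\Delta)$ is an ASI conformal bialgebra if $$r\bullet r\equiv0\ \ \mathrm{mod}\ (\partial^{\otimes^3}).$$
   Context: Everything is over $\mathbb{C}$. An associative conformal algebra is a $\mathbb{C}[\partial]$-module $A$ with a $\mathbb{C}$-bilinear map $A\times A\to A[\lambda]$, $(a,b)\mapsto a_\lambda b$, such that $(\partial a)_\lambda b=-\lambda a_\lambda b$, $a_\lambda(\partial b)=(\partial+\lambda)(a_\lambda b)$ and $(a_\lambda b)_{\lambda+\mu}c=a_\lambda(b_\mu c)$. $L_A(a)_\lambda b=a_\lambda b$ and $R_A(a)_\lambda b=b_{-\lambda-\partial}a$, where $b_{-\lambda-\partial}a$ means: write $b_\nu a=\sum_k\nu^kc_k$ and take $\sum_k(-\lambda-\partial)^kc_k$. $\tau(x\otimes y)=y\otimes x$; $r$ is antisymmetric if $\tau r=-r$. $\partial^{\otimes^2}=\partial\otimes1+1\otimes\partial$ and $\partial^{\otimes^3}=\partial\otimes1\otimes1+1\otimes\partial\otimes1+1\otimes1\otimes\partial$. Substituting an expression involving such operators for a variable $\nu$ in an element of $A^{\otimes m}[\nu]$ means replacing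 each power of $\nu$ by the corresponding power of the expression acting on the coefficient in $A^{\otimes m}$; e.g. $I\otimes R_A(b)_{-\lambda-\partial^{\otimes^2}}$ is obtained from $I\otimes R_A(b)_\nu:A\otimes A\to(A\otimes A)[\nu]$ by substituting $\nu=-\lambda-\partial^{\otimes^2}$ in the output. For $r=\sum_ir_i\otimes l_i$, $$r\bullet r=\sum_{i,j}\Big(r_i\otimes r_j\otimes{l_i}_\mu l_j\big|_{\mu=\partial\otimes1\otimes1}-r_i\otimes{r_j}_\mu l_i\otimes l_j\big|_{\mu=-\partial^{\otimes^2}\otimes1}+{r_i}_\mu r_j\otimes l_i\otimes l_j\big|_{\mu=1\otimes\partial\otimes1}\Big)\in A\otimes A\otimes A,$$ and $\equiv0\ \mathrm{mod}\ (\partial^{\otimes^3})$ means membership in $\partial^{\otimes^3}(A\otimes A\otimes A)$. (This congruence is called the associative conformal Yang-Baxter equation in $A$.) An associative conformal coalgebra is a $\mathbb{C}[\partial]$-module $A$ with a $\mathbb{C}[\partial]$-module homomorphism $\Delta:A\to A\otimes A$ ($\partial$ acting on $A\otimes A$ as $\partial^{\otimes^2}$) with $(I\otimes\Delta)\Delta=(\Delta\otimes I)\Delta$. An antisymmetric infinitesimal (ASI) conformal bialgebra $(A,\cdot_\lambda\cdot,\Delta)$ consists of an associative conformal algebra $(A,\cdot_\lambda\cdot)$ and an associative conformal coalgebra $(A,\Delta)$ such that for all $a,b\in A$ $\Delta(a_\lambda b)=(I\otimes L_A(a)_\lambda)\Delta(b)+(R_A(b)_{-\lambda-\partial^{\otimes^2}}\otimes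 I)\Delta(a)$ and $(L_A(b)_{-\lambda-\partial^{\otimes^2}}\otimes I-I\otimes R_A(b)_{-\lambda-\partial^{\otimes^2}})\Delta(a)+\tau(L_A(a)_\lambda\otimes I-I\otimes R_A(a)_\lambda)\Delta(b)=0$. *)

theory Defs
  imports Complex_Main "HOL-Library.Poly_Mapping" "HOL-Computational_Algebra.Polynomial"
begin

section \<open>Complex vector spaces\<close>

class complex_vector = ab_group_add +
  fixes scaleC :: "complex \<Rightarrow> 'a \<Rightarrow> 'a"  (infixr \<open>*\<^sub>C\<close> 75)
  assumes scaleC_add_right: "c *\<^sub>C (x + y) = c *\<^sub>C x + c *\<^sub>C y"
    and scaleC_add_left: "(c + d) *\<^sub>C x = c *\<^sub>C x + d *\<^sub>C x"
    and scaleC_scaleC: "c *\<^sub>C d *\<^sub>C x = (c * d) *\<^sub>C x"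
    and scaleC_one: "1 *\<^sub>C x = x"

global_interpretation complex_vector: vector_space "scaleC :: complex \<Rightarrow> 'a \<Rightarrow> 'a::complex_vector"
  by unfold_locales (simp_all add: scaleC_add_right scaleC_add_left scaleC_scaleC scaleC_one)

abbreviation complex_linear :: "('a::complex_vector \<Rightarrow> 'b::complex_vector) \<Rightarrow> bool"
  where "complex_linear f \<equiv> Vector_Spaces.linear scaleC scaleC f"

definition complex_bilinear ::
    "('a::complex_vector \<Rightarrow> 'b::complex_vector \<Rightarrow> 'c::complex_vector) \<Rightarrow> bool"
  where "complex_bilinear f \<longleftrightarrow> (\<forall>x. complex_linear (f x)) \<and> (\<forall>y. complex_linear (\<lambda>x. f x y))"

lemma complex_linear_iff:
  "complex_linear f \<longleftrightarrow> (\<forall>x y. f (x + y) = f x + f y) \<and> (\<forall>c x. f (c *\<^sub>C x) = c *\<^sub>C f x)"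
  unfolding Vector_Spaces.linear_iff
  using complex_vector.vector_space_axioms[where ?'a = 'a]
    complex_vector.vector_space_axioms[where ?'a = 'b] by blast

lemma
  assumes "complex_linear f"
  shows complex_linear_add: "f (x + y) = f x + f y"
    and complex_linear_scale: "f (c *\<^sub>C x) = c *\<^sub>C f x"
    and complex_linear_0: "f 0 = 0"
    and complex_linear_minus: "f (- x) = - f x"
    and complex_linear_diff: "f (x - y) = f x - f y"
    and complex_linear_sum: "f (\<Sum>i\<in>I. g i) = (\<Sum>i\<in>I. f (g i))"
proof -
  interpret Vector_Spaces.linear scaleC scaleC f by fact
  show "f (x + y) = f x + f y" "f (c *\<^sub>C x) = c *\<^sub>C f x" "f 0 = 0" "f (- x) = - f x"
    "f (x - y) = f x - f y" "f (\<Sum>i\<in>I. g i) = (\<Sum>i\<in>I. f (g i))"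
    by (simp_all add: add scale neg diff sum)
qed

lemma complex_bilinear_iff:
  "complex_bilinear f \<longleftrightarrow>
     (\<forall>x y z. f (x + y) z = f x z + f y z) \<and> (\<forall>c x z. f (c *\<^sub>C x) z = c *\<^sub>C f x z) \<and>
     (\<forall>x y z. f z (x + y) = f z x + f z y) \<and> (\<forall>c x z. f z (c *\<^sub>C x) = c *\<^sub>C f z x)"
  by (auto simp: complex_bilinear_def complex_linear_iff)

lemma complex_bilinear_sum:
  assumes "complex_bilinear f"
  shows "f (\<Sum>i\<in>I. g i) y = (\<Sum>i\<in>I. f (g i) y)" "f x (\<Sum>i\<in>J. h i) = (\<Sum>i\<in>J. f x (h i))"
  using assms complex_linear_sum[of "\<lambda>x. f x y"] complex_linear_sum[of "f x"]
  by (auto simp: complex_bilinear_def)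

instantiation complex :: complex_vector
begin
definition scaleC_complex :: "complex \<Rightarrow> complex \<Rightarrow> complex" where "scaleC_complex = (*)"
instance by standard (simp_all add: scaleC_complex_def algebra_simps)
end

instantiation poly_mapping :: (type, complex_vector) complex_vector
begin
lift_definition scaleC_poly_mapping :: "complex \<Rightarrow> ('a \<Rightarrow>\<^sub>0 'b) \<Rightarrow> 'a \<Rightarrow>\<^sub>0 'b"
  is "\<lambda>c p k. c *\<^sub>C p k"
  by (rule finite_subset[rotated]) auto
instance
  by standard
    (transfer; simp add: fun_eq_iff scaleC_add_right scaleC_add_left scaleC_scaleC scaleC_one)+
end

instantiation poly :: (complex_vector) complex_vector
begin
definition scaleC_poly :: "complex \<Rightarrow> 'a poly \<Rightarrow> 'a poly"
  where "scaleC_poly c p = map_poly (scaleC c) p"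
lemma coeff_scaleC [simp]: "coeff (c *\<^sub>C p) n = c *\<^sub>C coeff p n"
  by (simp add: scaleC_poly_def coeff_map_poly)
instance
  by standard
    (rule poly_eqI; simp add: scaleC_add_right scaleC_add_left scaleC_scaleC scaleC_one)+
end


section \<open>Tensor products over the complex numbers\<close>

definition tensor_relations ::
    "('a::complex_vector \<times> 'b::complex_vector \<Rightarrow>\<^sub>0 complex) set" where
  "tensor_relations =
     {Poly_Mapping.single (x + x', y) 1 - Poly_Mapping.single (x, y) 1
        - Poly_Mapping.single (x', y) 1 | x x' y. True} \<union>
     {Poly_Mapping.single (x, y + y') 1 - Poly_Mapping.single (x, y) 1
        - Poly_Mapping.single (x, y') 1 | x y y'. True} \<union>
     {Poly_Mapping.single (c *\<^sub>C x, y) 1 - c *\<^sub>C Poly_Mapping.single (x, y) 1 | c x y. True} \<union>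
     {Poly_Mapping.single (x, c *\<^sub>C y) 1 - c *\<^sub>C Poly_Mapping.single (x, y) 1 | c x y. True}"

definition tensor_eq ::
    "('a::complex_vector \<times> 'b::complex_vector \<Rightarrow>\<^sub>0 complex) \<Rightarrow> ('a \<times> 'b \<Rightarrow>\<^sub>0 complex) \<Rightarrow> bool"
  where "tensor_eq p q \<longleftrightarrow> p - q \<in> complex_vector.span tensor_relations"

quotient_type (overloaded) ('a, 'b) tensor (infixr \<open>\<otimes>\<close> 70) =
  "('a::complex_vector \<times> 'b::complex_vector) \<Rightarrow>\<^sub>0 complex" / tensor_eq
proof (rule equivpI)
  show "reflp tensor_eq"
    by (auto simp: reflp_def tensor_eq_def complex_vector.span_zero)
  show "symp tensor_eq"
    by (auto simp: symp_def tensor_eq_def dest: complex_vector.span_neg)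
  show "transp tensor_eq"
    by (auto simp: transp_def tensor_eq_def dest: complex_vector.span_add)
qed

instantiation tensor :: (complex_vector, complex_vector) complex_vector
begin
lift_definition zero_tensor :: "'a \<otimes> 'b" is 0 .
lift_definition plus_tensor :: "'a \<otimes> 'b \<Rightarrow> 'a \<otimes> 'b \<Rightarrow> 'a \<otimes> 'b" is "(+)"
  unfolding tensor_eq_def by (metis add_diff_add complex_vector.span_add)
lift_definition uminus_tensor :: "'a \<otimes> 'b \<Rightarrow> 'a \<otimes> 'b" is uminus
  unfolding tensor_eq_def by (metis complex_vector.span_neg minus_diff_minus)
lift_definition minus_tensor :: "'a \<otimes> 'b \<Rightarrow> 'a \<otimes> 'b \<Rightarrow> 'a \<otimes> 'b" is "(-)"
  unfolding tensor_eq_def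
proof -
  fix p p' q q' :: "'a \<times> 'b \<Rightarrow>\<^sub>0 complex"
  assume "p - p' \<in> complex_vector.span tensor_relations" "q - q' \<in> complex_vector.span tensor_relations"
  then have "(p - p') - (q - q') \<in> complex_vector.span tensor_relations"
    by (rule complex_vector.span_diff)
  then show "p - q - (p' - q') \<in> complex_vector.span tensor_relations"
    by (simp add: algebra_simps)
qed
lift_definition scaleC_tensor :: "complex \<Rightarrow> 'a \<otimes> 'b \<Rightarrow> 'a \<otimes> 'b" is scaleC
  unfolding tensor_eq_def
  by (metis complex_vector.span_scale complex_vector.scale_right_diff_distrib)
instance
  by standard
    (transfer; simp add: tensor_eq_def complex_vector.span_zero algebra_simps
       scaleC_add_right scaleC_add_left scaleC_scaleC scaleC_one)+
end

lift_definition elem_tensor :: "'a::complex_vector \<Rightarrow> 'b::complex_vector \<Rightarrow> 'a \<otimes> 'b"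
    (infixr \<open>\<otimes>\<close> 70)
  is "\<lambda>x y. Poly_Mapping.single (x, y) 1" .

definition free_extension :: "('i \<Rightarrow> 'v::complex_vector) \<Rightarrow> ('i \<Rightarrow>\<^sub>0 complex) \<Rightarrow> 'v"
  where "free_extension f p = (\<Sum>k\<in>Poly_Mapping.keys p. Poly_Mapping.lookup p k *\<^sub>C f k)"

lemma free_extension_superset:
  assumes "finite K" "Poly_Mapping.keys p \<subseteq> K"
  shows "free_extension f p = (\<Sum>k\<in>K. Poly_Mapping.lookup p k *\<^sub>C f k)"
  unfolding free_extension_def using assms
  by (intro sum.mono_neutral_left) (auto simp: in_keys_iff)

lemma lookup_scaleC [simp]:
  "Poly_Mapping.lookup (c *\<^sub>C p) k = c *\<^sub>C Poly_Mapping.lookup p k"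
  by transfer simp

lemma complex_linear_free_extension: "complex_linear (free_extension f)"
  unfolding complex_linear_iff
proof (intro conjI allI)
  fix p q :: "'a \<Rightarrow>\<^sub>0 complex" and c
  let ?K = "Poly_Mapping.keys p \<union> Poly_Mapping.keys q"
  have "free_extension f (p + q) = (\<Sum>k\<in>?K. Poly_Mapping.lookup (p + q) k *\<^sub>C f k)"
    by (rule free_extension_superset) (simp_all add: Poly_Mapping.keys_add)
  also have "\<dots> = (\<Sum>k\<in>?K. Poly_Mapping.lookup p k *\<^sub>C f k) + (\<Sum>k\<in>?K. Poly_Mapping.lookup q k *\<^sub>C f k)"
    by (simp add: lookup_add scaleC_add_left sum.distrib)
  also have "\<dots> = free_extension f p + free_extension f q"
    by (simp add: free_extension_superset[symmetric])
  finally show "free_extension f (p + q) = free_extension f p + free_extension f q" .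
  have "free_extension f (c *\<^sub>C p) =
      (\<Sum>k\<in>Poly_Mapping.keys p. Poly_Mapping.lookup (c *\<^sub>C p) k *\<^sub>C f k)"
    by (rule free_extension_superset) (auto simp: in_keys_iff scaleC_complex_def)
  also have "\<dots> = c *\<^sub>C free_extension f p"
    by (simp add: free_extension_def scaleC_complex_def scaleC_scaleC complex_vector.scale_sum_right)
  finally show "free_extension f (c *\<^sub>C p) = c *\<^sub>C free_extension f p" .
qed

lemma free_extension_single [simp]: "free_extension f (Poly_Mapping.single k c) = c *\<^sub>C f k"
  by (simp add: free_extension_def)

lemma free_extension_tensor_eq:
  assumes "complex_bilinear f" "tensor_eq p q"
  shows "free_extension (\<lambda>(x, y). f x y) p = free_extension (\<lambda>(x, y). f x y) q"
proof -
  let ?F = "free_extension (\<lambda>(x, y). f x y)"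
  note L = complex_linear_free_extension[of "\<lambda>(x, y). f x y"]
  have rel: "?F t = 0" if "t \<in> tensor_relations" for t
    using that assms(1) unfolding tensor_relations_def
    by (auto simp: complex_linear_diff[OF L] complex_linear_scale[OF L] scaleC_one
        complex_bilinear_iff)
  have "?F t = 0" if "t \<in> complex_vector.span tensor_relations" for t
    using that
  proof (induction rule: complex_vector.span_induct_alt)
    case base
    then show ?case by (simp add: complex_linear_0[OF L])
  next
    case (step c x y)
    then show ?case
      by (simp add: complex_linear_add[OF L] complex_linear_scale[OF L] rel)
  qed
  with assms(2) show ?thesis
    by (fastforce simp: tensor_eq_def complex_linear_diff[OF L])
qed

text \<open>The linear map out of a tensor product induced by a bilinear map; it is set to zero on
  arguments that are not bilinear.\<close>

lift_definition tensor_lift ::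
    "('a::complex_vector \<Rightarrow> 'b::complex_vector \<Rightarrow> 'c::complex_vector) \<Rightarrow> 'a \<otimes> 'b \<Rightarrow> 'c"
  is "\<lambda>f p. if complex_bilinear f then free_extension (\<lambda>(x, y). f x y) p else 0"
  by (auto intro: free_extension_tensor_eq)

lemma complex_linear_tensor_lift: "complex_linear (tensor_lift f)"
  unfolding complex_linear_iff
  by (auto; transfer)
    (auto simp: complex_linear_add[OF complex_linear_free_extension]
      complex_linear_scale[OF complex_linear_free_extension])

lemma tensor_lift_elem [simp]:
  "complex_bilinear f \<Longrightarrow> tensor_lift f (x \<otimes> y) = f x y"
  by transfer (simp add: scaleC_one)

lemma tensor_relationsI:
  "Poly_Mapping.single (x + x', y) 1 - Poly_Mapping.single (x, y) 1 - Poly_Mapping.single (x', y) 1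
    \<in> tensor_relations"
  "Poly_Mapping.single (x, y + y') 1 - Poly_Mapping.single (x, y) 1 - Poly_Mapping.single (x, y') 1
    \<in> tensor_relations"
  "Poly_Mapping.single (c *\<^sub>C x, y) 1 - c *\<^sub>C Poly_Mapping.single (x, y) 1 \<in> tensor_relations"
  "Poly_Mapping.single (x, c *\<^sub>C y) 1 - c *\<^sub>C Poly_Mapping.single (x, y) 1 \<in> tensor_relations"
  unfolding tensor_relations_def by blast+

lemma complex_bilinear_elem_tensor: "complex_bilinear elem_tensor"
  unfolding complex_bilinear_iff
proof (intro conjI allI)
  show "(x + y) \<otimes> z = x \<otimes> z + y \<otimes> z" for x y :: 'a and z :: 'b
    by transfer (simp add: tensor_eq_def diff_diff_eq[symmetric] complex_vector.span_base
        tensor_relationsI)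
  show "z \<otimes> (x + y) = z \<otimes> x + z \<otimes> y" for x y :: 'b and z :: 'a
    by transfer (simp add: tensor_eq_def diff_diff_eq[symmetric] complex_vector.span_base
        tensor_relationsI)
  show "(c *\<^sub>C x) \<otimes> z = c *\<^sub>C (x \<otimes> z)" for c and x :: 'a and z :: 'b
    by transfer (simp add: tensor_eq_def complex_vector.span_base tensor_relationsI)
  show "z \<otimes> (c *\<^sub>C x) = c *\<^sub>C (z \<otimes> x)" for c and x :: 'b and z :: 'a
    by transfer (simp add: tensor_eq_def complex_vector.span_base tensor_relationsI)
qed

lemma
  shows elem_tensor_add_left: "(x + y) \<otimes> z = x \<otimes> z + y \<otimes> z"
    and elem_tensor_scaleC_left: "(c *\<^sub>C x) \<otimes> z = c *\<^sub>C (x \<otimes> z)"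
    and elem_tensor_add_right: "x \<otimes> (z + w) = x \<otimes> z + x \<otimes> w"
    and elem_tensor_scaleC_right: "x \<otimes> (c *\<^sub>C z) = c *\<^sub>C (x \<otimes> z)"
  by (simp_all add: complex_bilinear_elem_tensor[unfolded complex_bilinear_iff])

lemmas elem_tensor_bilinear_simps =
  elem_tensor_add_left elem_tensor_scaleC_left elem_tensor_add_right elem_tensor_scaleC_right

lemma elem_tensor_0 [simp]: "0 \<otimes> x = 0" "x \<otimes> 0 = 0"
  using elem_tensor_scaleC_left[of 0 0 x] elem_tensor_scaleC_right[of x 0 0] by simp_all

lemma tensor_is_sum: "\<exists>I :: ('a \<times> 'b) set. \<exists>c. finite I \<and>
    (t :: 'a::complex_vector \<otimes> 'b::complex_vector) = (\<Sum>(x, y)\<in>I. (c (x, y) *\<^sub>C x) \<otimes> y)"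
proof -
  obtain p where p: "t = abs_tensor p"
    by (metis Quotient_abs_rep[OF Quotient_tensor])
  have lin: "complex_linear (abs_tensor :: _ \<Rightarrow> 'a \<otimes> 'b)"
    by (simp add: complex_linear_iff plus_tensor.abs_eq scaleC_tensor.abs_eq)
  have "p = (\<Sum>k\<in>Poly_Mapping.keys p. Poly_Mapping.lookup p k *\<^sub>C Poly_Mapping.single k 1)"
    by (rule poly_mapping_eqI)
      (simp add: lookup_sum lookup_single scaleC_complex_def when_def if_distrib in_keys_iff cong: if_cong)
  then have "t = (\<Sum>k\<in>Poly_Mapping.keys p. Poly_Mapping.lookup p k *\<^sub>C
      abs_tensor (Poly_Mapping.single k 1))"
    unfolding p by (metis (no_types, lifting) complex_linear_sum[OF lin] complex_linear_scale[OF lin] sum.cong)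
  also have "\<dots> = (\<Sum>(x, y)\<in>Poly_Mapping.keys p. (Poly_Mapping.lookup p (x, y) *\<^sub>C x) \<otimes> y)"
    by (intro sum.cong) (auto simp: elem_tensor_scaleC_left elem_tensor.abs_eq[symmetric])
  finally show ?thesis using finite_keys by blast
qed

lemma tensor_induct [case_names zero add]:
  fixes t :: "'a::complex_vector \<otimes> 'b::complex_vector"
  assumes "P 0" "\<And>x y t. P t \<Longrightarrow> P (x \<otimes> y + t)"
  shows "P t"
proof -
  obtain I :: "('a \<times> 'b) set" and c
    where I: "finite I" and t: "t = (\<Sum>(x, y)\<in>I. (c (x, y) *\<^sub>C x) \<otimes> y)"
    using tensor_is_sum by blast
  from I show ?thesis unfolding t
    by (induction I rule: finite_induct) (auto simp: assms split: prod.split)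
qed

lemma complex_linear_tensor_lift_param:
  assumes "\<And>w. complex_bilinear (F w)" "\<And>x y. complex_linear (\<lambda>w. F w x y)"
  shows "complex_linear (\<lambda>w. tensor_lift (F w) t)"
proof (induction t rule: tensor_induct)
  case zero
  then show ?case
    by (simp add: complex_linear_0[OF complex_linear_tensor_lift] complex_linear_iff)
next
  case (add x y t)
  then show ?case
    using assms(2)[of x y]
    by (simp add: complex_linear_add[OF complex_linear_tensor_lift] tensor_lift_elem[OF assms(1)]
        complex_linear_iff scaleC_add_right algebra_simps)
qed

definition tensor_map ::
    "('a \<Rightarrow> 'c) \<Rightarrow> ('b \<Rightarrow> 'd) \<Rightarrow> 'a::complex_vector \<otimes> 'b::complex_vector \<Rightarrow>
      'c::complex_vector \<otimes> 'd::complex_vector"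
  where "tensor_map f g = tensor_lift (\<lambda>x y. f x \<otimes> g y)"

definition tensor_swap :: "'a::complex_vector \<otimes> 'b::complex_vector \<Rightarrow> 'b \<otimes> 'a"
  where "tensor_swap = tensor_lift (\<lambda>x y. y \<otimes> x)"

definition tensor_assoc ::
    "('a::complex_vector \<otimes> 'b::complex_vector) \<otimes> 'c::complex_vector \<Rightarrow> 'a \<otimes> 'b \<otimes> 'c"
  where "tensor_assoc = tensor_lift (\<lambda>t z. tensor_lift (\<lambda>x y. x \<otimes> y \<otimes> z) t)"

lemma tensor_map_elem:
  "complex_linear f \<Longrightarrow> complex_linear g \<Longrightarrow> tensor_map f g (x \<otimes> y) = f x \<otimes> g y"
  unfolding tensor_map_def
  by (subst tensor_lift_elem)
    (auto simp: complex_bilinear_iff complex_linear_iff elem_tensor_bilinear_simps)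

lemma complex_linear_tensor_map: "complex_linear (tensor_map f g)"
  unfolding tensor_map_def by (rule complex_linear_tensor_lift)

lemma tensor_swap_elem: "tensor_swap (x \<otimes> y) = y \<otimes> x"
  unfolding tensor_swap_def
  by (subst tensor_lift_elem) (auto simp: complex_bilinear_iff elem_tensor_bilinear_simps)

lemma tensor_assoc_elem: "tensor_assoc ((x \<otimes> y) \<otimes> z) = x \<otimes> y \<otimes> z"
proof -
  note b = elem_tensor_bilinear_simps
  have 1: "complex_bilinear (\<lambda>(x::'a) (y::'b). x \<otimes> y \<otimes> (z::'c))" for z
    by (auto simp: complex_bilinear_iff b)
  have "complex_bilinear (\<lambda>t z. tensor_lift (\<lambda>(x::'a) (y::'b). x \<otimes> y \<otimes> (z::'c)) t)"
    unfolding complex_bilinear_def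
    by (intro conjI allI complex_linear_tensor_lift complex_linear_tensor_lift_param 1)
      (auto simp: complex_linear_iff b)
  then show ?thesis by (simp add: tensor_assoc_def 1)
qed


section \<open>Polynomials with vector coefficients\<close>

text \<open>For a vector space \<open>V\<close>, the space \<open>V[\<lambda>]\<close> is \<open>V poly\<close>, and multiplication by \<open>\<lambda>\<close> is
  \<^term>\<open>pCons 0\<close>. In \<open>V poly poly\<close> the outer variable is \<open>\<mu>\<close> and the inner one \<open>\<lambda>\<close>, so that
  \<open>\<mu>\<close> acts as \<^term>\<open>pCons 0\<close> and \<open>\<lambda>\<close> as \<^term>\<open>map_poly (pCons 0)\<close>.\<close>

text \<open>Substitution of the operator \<open>T\<close> for the variable.\<close>

definition op_subst :: "('v \<Rightarrow> 'v) \<Rightarrow> 'v::comm_monoid_add poly \<Rightarrow> 'v"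
  where "op_subst T p = (\<Sum>k\<le>degree p. (T ^^ k) (coeff p k))"

text \<open>Substitution of \<open>-\<lambda> - D\<close> for the variable, the result being a polynomial in \<open>\<lambda>\<close>.\<close>

definition neg_shift_subst :: "('v \<Rightarrow> 'v) \<Rightarrow> 'v::ab_group_add poly \<Rightarrow> 'v poly"
  where "neg_shift_subst D p =
    op_subst (\<lambda>q. - pCons 0 q - map_poly D q) (map_poly (\<lambda>v. [:v:]) p)"

text \<open>\<open>P\<^sub>\<lambda> \<otimes> I\<close> and \<open>I \<otimes> P\<^sub>\<lambda>\<close> for a map \<open>P\<^sub>\<lambda>\<close> with polynomial values.\<close>

definition tensor_poly_left ::
    "('a \<Rightarrow> 'c poly) \<Rightarrow> 'a::complex_vector \<otimes> 'b::complex_vector \<Rightarrow> ('c::complex_vector \<otimes> 'b) poly"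
  where "tensor_poly_left P = tensor_lift (\<lambda>x y. map_poly (\<lambda>z. z \<otimes> y) (P x))"

definition tensor_poly_right ::
    "('b \<Rightarrow> 'c poly) \<Rightarrow> 'a::complex_vector \<otimes> 'b::complex_vector \<Rightarrow> ('a \<otimes> 'c::complex_vector) poly"
  where "tensor_poly_right P = tensor_lift (\<lambda>x y. map_poly (\<lambda>z. x \<otimes> z) (P y))"

lemma complex_linear_map_poly:
  assumes "complex_linear f"
  shows "complex_linear (map_poly f)"
  unfolding complex_linear_iff
  by (auto intro!: poly_eqI simp: coeff_map_poly complex_linear_0[OF assms]
      complex_linear_add[OF assms] complex_linear_scale[OF assms])

lemma complex_bilinear_map_poly:
  assumes "complex_bilinear f"
  shows "complex_bilinear (\<lambda>x. map_poly (f x))"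
proof -
  have lin: "complex_linear (f x)" "complex_linear (\<lambda>x. f x y)" for x y
    using assms by (auto simp: complex_bilinear_def)
  show ?thesis
    unfolding complex_bilinear_def
    using complex_linear_map_poly[OF lin(1)]
    by (auto intro!: poly_eqI simp: complex_linear_iff coeff_map_poly complex_linear_0[OF lin(1)]
        complex_linear_add[OF lin(2)] complex_linear_scale[OF lin(2)])
qed

lemma funpow_additive_0:
  fixes T :: "'v::complex_vector \<Rightarrow> 'v"
  assumes "complex_linear T"
  shows "complex_linear (T ^^ k)"
  using assms by (induction k) (auto simp: complex_linear_iff)

lemma op_subst_superset:
  assumes "complex_linear T" "degree p \<le> n"
  shows "op_subst T p = (\<Sum>k\<le>n. (T ^^ k) (coeff p k))"
  unfolding op_subst_def using assms(2)
  by (intro sum.mono_neutral_left)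
    (auto simp: coeff_eq_0 complex_linear_0[OF funpow_additive_0[OF assms(1)]])

lemma complex_linear_op_subst:
  assumes "complex_linear T"
  shows "complex_linear (op_subst T)"
  unfolding complex_linear_iff
proof (intro conjI allI)
  note k = funpow_additive_0[OF assms]
  fix p q :: "'a poly" and c
  let ?n = "max (degree p) (degree q)"
  show "op_subst T (p + q) = op_subst T p + op_subst T q"
    using degree_add_le_max[of p q]
    by (simp add: op_subst_superset[OF assms, of _ ?n] complex_linear_add[OF k] sum.distrib)
  have "degree (c *\<^sub>C p) \<le> degree p"
    by (rule degree_le) (simp add: coeff_eq_0)
  then show "op_subst T (c *\<^sub>C p) = c *\<^sub>C op_subst T p"
    by (simp add: op_subst_superset[OF assms, of _ "degree p"] complex_linear_scale[OF k]
        complex_vector.scale_sum_right)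
qed

lemma tensor_poly_left_elem:
  fixes P :: "'a::complex_vector \<Rightarrow> 'c::complex_vector poly" and y :: "'b::complex_vector"
  assumes "complex_linear P"
  shows "tensor_poly_left P (x \<otimes> y) = map_poly (\<lambda>z. z \<otimes> y) (P x)"
proof -
  have "complex_bilinear (\<lambda>y. map_poly (\<lambda>z::'c. z \<otimes> (y::'b)))"
    by (intro complex_bilinear_map_poly) (simp add: complex_bilinear_iff elem_tensor_bilinear_simps)
  then have "complex_bilinear (\<lambda>x y. map_poly (\<lambda>z. z \<otimes> (y::'b)) (P x))"
    using assms by (simp add: complex_bilinear_iff complex_linear_iff)
  then show ?thesis by (simp add: tensor_poly_left_def)
qed

lemma tensor_poly_right_elem:
  fixes P :: "'b::complex_vector \<Rightarrow> 'c::complex_vector poly" and x :: "'a::complex_vector"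
  assumes "complex_linear P"
  shows "tensor_poly_right P (x \<otimes> y) = map_poly (\<lambda>z. x \<otimes> z) (P y)"
proof -
  have "complex_bilinear (\<lambda>x y. map_poly (\<lambda>z. (x::'a) \<otimes> z) (P y))"
    using assms
      complex_bilinear_map_poly[OF complex_bilinear_elem_tensor[where ?'a = 'a and ?'b = 'c]]
    by (simp add: complex_bilinear_iff complex_linear_iff)
  then show ?thesis by (simp add: tensor_poly_right_def)
qed


section \<open>Associative conformal algebras and ASI conformal bialgebras\<close>

text \<open>A \<open>\<complex>[\<partial>]\<close>-module is a complex vector space with a linear endomorphism \<open>D\<close>. The associativity
  axiom is an identity in \<open>A[\<lambda>,\<mu>] = A poly poly\<close>.\<close>

locale assoc_conformal_algebra =
  fixes D :: "'a::complex_vector \<Rightarrow> 'a"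
    and lprod :: "'a \<Rightarrow> 'a \<Rightarrow> 'a poly"
  assumes linear_D: "complex_linear D"
    and bilinear_lprod: "complex_bilinear lprod"
    and D_left: "lprod (D a) b = - pCons 0 (lprod a b)"
    and D_right: "lprod a (D b) = map_poly D (lprod a b) + pCons 0 (lprod a b)"
    and assoc:
      "op_subst (map_poly (pCons 0))
         (map_poly
           (\<lambda>x. op_subst (\<lambda>q. map_poly (pCons 0) q + pCons 0 q) (map_poly (\<lambda>z. [:[:z:]:]) (lprod x c)))
           (lprod a b)) =
       map_poly (lprod a) (lprod b c)"

text \<open>\<open>\<partial>\<^sup>\<otimes>\<^sup>2\<close> and \<open>\<partial>\<^sup>\<otimes>\<^sup>3\<close>\<close>

definition tensor_D2 :: "('a \<Rightarrow> 'a) \<Rightarrow> 'a::complex_vector \<otimes> 'a \<Rightarrow> 'a \<otimes> 'a"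
  where "tensor_D2 D t = tensor_map D id t + tensor_map id D t"

definition tensor_D3 :: "('a \<Rightarrow> 'a) \<Rightarrow> 'a::complex_vector \<otimes> 'a \<otimes> 'a \<Rightarrow> 'a \<otimes> 'a \<otimes> 'a"
  where "tensor_D3 D t =
    tensor_map D id t + tensor_map id (tensor_map D id) t + tensor_map id (tensor_map id D) t"

text \<open>\<open>R\<^sub>A(a)\<^sub>\<lambda>\<close>; the operator \<open>L\<^sub>A(a)\<^sub>\<lambda>\<close> is just \<open>lprod a\<close>.\<close>

definition right_mult ::
    "('a \<Rightarrow> 'a) \<Rightarrow> ('a \<Rightarrow> 'a \<Rightarrow> 'a poly) \<Rightarrow> 'a \<Rightarrow> 'a \<Rightarrow> 'a::complex_vector poly"
  where "right_mult D lprod a b = neg_shift_subst D (lprod b a)"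

locale assoc_conformal_coalgebra =
  fixes D :: "'a::complex_vector \<Rightarrow> 'a"
    and \<Delta> :: "'a \<Rightarrow> 'a \<otimes> 'a"
  assumes linear_D: "complex_linear D"
    and linear_\<Delta>: "complex_linear \<Delta>"
    and \<Delta>_D: "\<Delta> (D a) = tensor_D2 D (\<Delta> a)"
    and coassoc: "tensor_map id \<Delta> (\<Delta> a) = tensor_assoc (tensor_map \<Delta> id (\<Delta> a))"

text \<open>Both compatibility conditions are identities in \<open>(A \<otimes> A)[\<lambda>]\<close>.\<close>

locale asi_conformal_bialgebra =
  alg: assoc_conformal_algebra D lprod + coalg: assoc_conformal_coalgebra D \<Delta>
  for D :: "'a::complex_vector \<Rightarrow> 'a"
    and lprod :: "'a \<Rightarrow> 'a \<Rightarrow> 'a poly"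
    and \<Delta> :: "'a \<Rightarrow> 'a \<otimes> 'a" +
  assumes \<Delta>_lprod:
      "map_poly \<Delta> (lprod a b) =
         tensor_poly_right (lprod a) (\<Delta> b) +
         neg_shift_subst (tensor_D2 D) (tensor_poly_left (right_mult D lprod b) (\<Delta> a))"
    and \<Delta>_antisym:
      "neg_shift_subst (tensor_D2 D) (tensor_poly_left (lprod b) (\<Delta> a)) -
       neg_shift_subst (tensor_D2 D) (tensor_poly_right (right_mult D lprod b) (\<Delta> a)) +
       map_poly tensor_swap
         (tensor_poly_left (lprod a) (\<Delta> b) - tensor_poly_right (right_mult D lprod a) (\<Delta> b)) = 0"

definition coboundary ::
    "('a \<Rightarrow> 'a) \<Rightarrow> ('a \<Rightarrow> 'a \<Rightarrow> 'a poly) \<Rightarrow> 'a::complex_vector \<otimes> 'a \<Rightarrow> 'a \<Rightarrow> 'a \<otimes> 'a"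
  where "coboundary D lprod r a =
    op_subst (\<lambda>t. - tensor_D2 D t)
      (tensor_poly_right (lprod a) r - tensor_poly_left (right_mult D lprod a) r)"

text \<open>The summand of \<open>r \<bullet> r\<close> for \<open>r\<^sub>i \<otimes> l\<^sub>i = x \<otimes> y\<close> and \<open>r\<^sub>j \<otimes> l\<^sub>j = u \<otimes> v\<close>.\<close>

definition bullet_summand ::
    "('a \<Rightarrow> 'a) \<Rightarrow> ('a \<Rightarrow> 'a \<Rightarrow> 'a poly) \<Rightarrow> 'a \<Rightarrow> 'a \<Rightarrow> 'a \<Rightarrow> 'a \<Rightarrow> 'a::complex_vector \<otimes> 'a \<otimes> 'a"
  where "bullet_summand D lprod x y u v =
      op_subst (tensor_map D id) (map_poly (\<lambda>z. x \<otimes> u \<otimes> z) (lprod y v))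
    - op_subst (\<lambda>t. - (tensor_map D id t + tensor_map id (tensor_map D id) t))
        (map_poly (\<lambda>z. x \<otimes> z \<otimes> v) (lprod u y))
    + op_subst (tensor_map id (tensor_map D id)) (map_poly (\<lambda>z. z \<otimes> y \<otimes> v) (lprod x u))"

definition bullet ::
    "('a \<Rightarrow> 'a) \<Rightarrow> ('a \<Rightarrow> 'a \<Rightarrow> 'a poly) \<Rightarrow> 'a::complex_vector \<otimes> 'a \<Rightarrow> 'a \<otimes> 'a \<otimes> 'a"
  where "bullet D lprod r =
    tensor_lift (\<lambda>x y. tensor_lift (\<lambda>u v. bullet_summand D lprod x y u v) r) r"

context assoc_conformal_algebra
begin

lemma complex_bilinear_bullet_summand:
  "complex_bilinear (\<lambda>u v. bullet_summand D lprod x y u v)"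
  "complex_bilinear (\<lambda>x y. bullet_summand D lprod x y u v)"
proof -
  note b = elem_tensor_bilinear_simps
  have m: "complex_linear (tensor_map D id :: 'a \<otimes> 'a \<otimes> 'a \<Rightarrow> _)"
    "complex_linear (tensor_map id (tensor_map D id) :: 'a \<otimes> 'a \<otimes> 'a \<Rightarrow> _)"
    by (rule complex_linear_tensor_map)+
  have m': "complex_linear (\<lambda>t :: 'a \<otimes> 'a \<otimes> 'a.
      - (tensor_map D id t + tensor_map id (tensor_map D id) t))"
    unfolding complex_linear_iff complex_linear_add[OF m(1)] complex_linear_add[OF m(2)]
      complex_linear_scale[OF m(1)] complex_linear_scale[OF m(2)]
    by (simp add: complex_vector.scale_minus_right complex_vector.scale_right_diff_distrib)
  have p: "map_poly (\<lambda>z. f z + g z) q = map_poly f q + map_poly g q"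
    "map_poly (\<lambda>z. c *\<^sub>C f z) q = c *\<^sub>C map_poly f q"
    if "f 0 = 0" "g 0 = 0" for f g :: "'a \<Rightarrow> 'a \<otimes> 'a \<otimes> 'a" and q c
    using that by (auto intro!: poly_eqI simp: coeff_map_poly)
  have l: "map_poly f (q + q') = map_poly f q + map_poly f q'"
    "map_poly f (c *\<^sub>C q) = c *\<^sub>C map_poly f q"
    if "complex_linear f" for f :: "'a \<Rightarrow> 'a \<otimes> 'a \<otimes> 'a" and q q' c
    using complex_linear_map_poly[OF that] by (auto simp: complex_linear_iff)
  have f: "complex_linear (\<lambda>z. x \<otimes> u \<otimes> z)" "complex_linear (\<lambda>z. x \<otimes> z \<otimes> v)"
    "complex_linear (\<lambda>z. z \<otimes> y \<otimes> v)" for x u v y :: 'a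
    by (auto simp: complex_linear_iff b)
  note s = complex_linear_op_subst[OF m(1), unfolded complex_linear_iff]
    complex_linear_op_subst[OF m(2), unfolded complex_linear_iff]
    complex_linear_op_subst[OF m', simplified, unfolded complex_linear_iff]
  note lp = bilinear_lprod[unfolded complex_bilinear_iff]
  show "complex_bilinear (\<lambda>u v. bullet_summand D lprod x y u v)"
    "complex_bilinear (\<lambda>x y. bullet_summand D lprod x y u v)"
    unfolding complex_bilinear_iff bullet_summand_def
    by (simp_all add: s lp b p l f scaleC_add_right complex_vector.scale_right_diff_distrib)
qed

lemma bullet_sum:
  "bullet D lprod (\<Sum>i\<in>I. x i \<otimes> y i) =
     (\<Sum>i\<in>I. \<Sum>j\<in>I. bullet_summand D lprod (x i) (y i) (x j) (y j))"
proof -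
  define r where "r = (\<Sum>i\<in>I. x i \<otimes> y i)"
  have b: "complex_bilinear (\<lambda>x y. tensor_lift (\<lambda>u v. bullet_summand D lprod x y u v) r)"
    unfolding complex_bilinear_def
    by (intro conjI allI complex_linear_tensor_lift_param complex_bilinear_bullet_summand)
      (use complex_bilinear_bullet_summand in \<open>auto simp: complex_bilinear_def\<close>)
  have "bullet D lprod r =
      (\<Sum>i\<in>I. tensor_lift (\<lambda>x y. tensor_lift (\<lambda>u v. bullet_summand D lprod x y u v) r) (x i \<otimes> y i))"
    unfolding bullet_def complex_linear_sum[OF complex_linear_tensor_lift, symmetric]
    by (simp add: r_def)
  also have "\<dots> = (\<Sum>i\<in>I. tensor_lift (\<lambda>u v. bullet_summand D lprod (x i) (y i) u v) r)"
    by (intro sum.cong refl tensor_lift_elem b)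
  also have "\<dots> = (\<Sum>i\<in>I. \<Sum>j\<in>I. bullet_summand D lprod (x i) (y i) (x j) (y j))"
    unfolding r_def complex_linear_sum[OF complex_linear_tensor_lift]
    by (intro sum.cong refl tensor_lift_elem complex_bilinear_bullet_summand)
  finally show ?thesis unfolding r_def .
qed

end

end

(* Put S = d1 + d2 + d3 on three factors, d_i being the derivation of the i-th
   factor.  By associativity and sesquilinearity alone, the defect of coassociativity
   (I (x) Delta) Delta(a) - (Delta (x) I) Delta(a) is the value at lambda = -S of
   (I (x) I (x) L(a)_lambda - R(a)_lambda (x) I (x) I)(r . r).  Moving S through L(a)_lambda or
   R(a)_lambda turns it into S + lambda, so this operator kills the image of S.  The first
   compatibility condition holds for every r; the first half of the second one for r is the second
   half for tau r, so the two cancel when tau r = -r. *)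
theory Submission
  imports Defs
begin

section \<open>Linear maps and substitution of operators\<close>

text \<open>Every term that occurs is a product p_nu q placed in one tensor slot, with nu replaced
  by a combination of derivations of the slots and, in the compatibility conditions, of lambda.
  These operators commute, so the value of a product at an operator is taken as the basic object;
  changes of variable in iterated polynomial rings are confined to one law, associativity evaluated
  at two commuting operators. The coassociativity defect is bilinear in r, so it is polarized to
  \<open>x \<otimes> y\<close> and \<open>u \<otimes> v\<close>. Each of the two composites then has
  four terms. Of these eight, x tensor u(ay) tensor v and x tensor (ua)y tensor v cancel by
  associativity. The other six are the three terms of the summand of r . r, once with a multiplied
  from the left into the last slot and once from the right into the first slot. The value lambda =
  -S appears because Delta commutes with the derivations: applying it to either factor turns d1 + d2
  into S. Operators such as -e2 - e3 are what remains of S when the derivations of other slots are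
  taken away.\<close>

lemma linear_ident: "complex_linear (\<lambda>x. x)"
  by (simp add: complex_linear_iff)

lemma linear_id: "complex_linear id"
  by (simp add: complex_linear_iff)

lemma linear_add:
  "complex_linear f \<Longrightarrow> complex_linear g \<Longrightarrow> complex_linear (\<lambda>x. f x + g x)"
  by (simp add: complex_linear_iff scaleC_add_right algebra_simps)

lemma linear_minus: "complex_linear f \<Longrightarrow> complex_linear (\<lambda>x. - f x)"
  by (simp add: complex_linear_iff complex_vector.scale_minus_right)

lemma linear_diff:
  "complex_linear f \<Longrightarrow> complex_linear g \<Longrightarrow> complex_linear (\<lambda>x. f x - g x)"
  by (simp add: complex_linear_iff complex_vector.scale_right_diff_distrib algebra_simps)

lemma linear_sum:
  "(\<And>i. i \<in> I \<Longrightarrow> complex_linear (f i)) \<Longrightarrow> complex_linear (\<lambda>x. \<Sum>i\<in>I. f i x)"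
  by (simp add: complex_linear_iff sum.distrib complex_vector.scale_sum_right)

lemma linear_compose:
  "complex_linear g \<Longrightarrow> complex_linear f \<Longrightarrow> complex_linear (\<lambda>x. g (f x))"
  by (simp add: complex_linear_iff)

lemma linear_elem_left: "complex_linear f \<Longrightarrow> complex_linear (\<lambda>x. f x \<otimes> y)"
  by (simp add: complex_linear_iff elem_tensor_bilinear_simps)

lemma linear_elem_right: "complex_linear f \<Longrightarrow> complex_linear (\<lambda>y. x \<otimes> f y)"
  by (simp add: complex_linear_iff elem_tensor_bilinear_simps)

lemma linear_pCons_0: "complex_linear f \<Longrightarrow> complex_linear (\<lambda>x. pCons 0 (f x))"
  by (auto simp: complex_linear_iff intro!: poly_eqI simp: coeff_pCons split: nat.split)

lemma linear_const_poly: "complex_linear f \<Longrightarrow> complex_linear (\<lambda>x. [:f x:])"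
  by (auto simp: complex_linear_iff intro!: poly_eqI simp: coeff_pCons split: nat.split)

lemma linear_map_poly:
  "complex_linear g \<Longrightarrow> complex_linear f \<Longrightarrow> complex_linear (\<lambda>x. map_poly g (f x))"
  by (rule linear_compose[OF complex_linear_map_poly])

lemma linear_tensor_map: "complex_linear f \<Longrightarrow> complex_linear (\<lambda>x. tensor_map g h (f x))"
  by (rule linear_compose[OF complex_linear_tensor_map])

lemma linear_op_subst:
  "complex_linear T \<Longrightarrow> complex_linear f \<Longrightarrow> complex_linear (\<lambda>x. op_subst T (f x))"
  by (rule linear_compose[OF complex_linear_op_subst])

lemma linear_tensor_swap: "complex_linear f \<Longrightarrow> complex_linear (\<lambda>x. tensor_swap (f x))"
  unfolding tensor_swap_def by (rule linear_compose[OF complex_linear_tensor_lift])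

lemma linear_tensor_assoc: "complex_linear f \<Longrightarrow> complex_linear (\<lambda>x. tensor_assoc (f x))"
  unfolding tensor_assoc_def by (rule linear_compose[OF complex_linear_tensor_lift])

lemma linear_tensor_poly_left:
  "complex_linear f \<Longrightarrow> complex_linear (\<lambda>x. tensor_poly_left P (f x))"
  unfolding tensor_poly_left_def by (rule linear_compose[OF complex_linear_tensor_lift])

lemma linear_tensor_poly_right:
  "complex_linear f \<Longrightarrow> complex_linear (\<lambda>x. tensor_poly_right P (f x))"
  unfolding tensor_poly_right_def by (rule linear_compose[OF complex_linear_tensor_lift])

lemma linear_tensor_D2: "complex_linear f \<Longrightarrow> complex_linear (\<lambda>x. tensor_D2 D (f x))"
  unfolding tensor_D2_def by (intro linear_add linear_tensor_map)

lemma linear_tensor_D3: "complex_linear f \<Longrightarrow> complex_linear (\<lambda>x. tensor_D3 D (f x))"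
  unfolding tensor_D3_def by (intro linear_add linear_tensor_map)

text \<open>The rules have an arbitrary linear argument \<open>f x\<close> in place of
  \<open>x\<close>, so that \<open>intro\<close> can peel a nested expression one operation at a
  time.\<close>

lemmas linear_intros =
  linear_ident linear_id linear_add linear_minus linear_diff linear_sum linear_elem_left linear_elem_right
  linear_pCons_0 linear_const_poly linear_map_poly linear_tensor_map linear_op_subst
  linear_tensor_swap linear_tensor_assoc linear_tensor_poly_left linear_tensor_poly_right
  linear_tensor_D2 linear_tensor_D3

section \<open>Reduction to elementary tensors and monomials\<close>

lemma tensor_eqI:
  assumes "complex_linear f" "complex_linear g" "\<And>x y. f (x \<otimes> y) = g (x \<otimes> y)"
  shows "f t = g t"
  by (induction t rule: tensor_induct)
    (simp_all add: assms complex_linear_0 complex_linear_add)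

lemma tensor3_eqI:
  assumes f: "complex_linear f" and g: "complex_linear g"
    and "\<And>x y z. f (x \<otimes> y \<otimes> z) = g (x \<otimes> y \<otimes> z)"
  shows "f t = g t"
proof (rule tensor_eqI[where t = t])
  show "f (x \<otimes> s) = g (x \<otimes> s)" for x s
    by (rule tensor_eqI[where t = s])
      (rule linear_compose[OF f] linear_compose[OF g] linear_elem_right linear_ident assms(3))+
qed fact+

lemma map_poly_pCons_linear:
  "complex_linear f \<Longrightarrow> map_poly f (pCons a p) = pCons (f a) (map_poly f p)"
  by (simp add: map_poly_pCons complex_linear_0)

lemma map_poly_compose:
  "complex_linear f \<Longrightarrow> complex_linear g \<Longrightarrow> map_poly f (map_poly g p) = map_poly (\<lambda>x. f (g x)) p"
  by (simp add: map_poly_map_poly complex_linear_0 o_def)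

section \<open>Calculus of substituting an operator for the variable\<close>

lemma op_subst_0 [simp]: "op_subst T 0 = 0"
  by (simp add: op_subst_def)

text \<open>Horner's rule. It makes substitution a recursion along \<open>pCons\<close>, so that
  later facts go by induction on the polynomial and never mention degrees.\<close>

lemma op_subst_pCons:
  assumes "complex_linear T"
  shows "op_subst T (pCons v p) = v + T (op_subst T p)"
proof -
  \<comment> \<open>For \<open>p = 0\<close> this bound exceeds the degree by one; the extra summand
    vanishes, which avoids a case distinction.\<close>
  have "op_subst T (pCons v p) = (\<Sum>k\<le>Suc (degree p). (T ^^ k) (coeff (pCons v p) k))"
    by (rule op_subst_superset[OF assms degree_pCons_le])
  also have "\<dots> = v + (\<Sum>k\<le>degree p. T ((T ^^ k) (coeff p k)))"
    by (subst sum.atMost_Suc_shift) simp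
  also have "(\<Sum>k\<le>degree p. T ((T ^^ k) (coeff p k))) = T (op_subst T p)"
    by (simp add: op_subst_def complex_linear_sum[OF assms])
  finally show ?thesis .
qed

text \<open>Powers of \<open>T\<close> pass through \<open>h\<close> as powers of \<open>T'\<close>.
  Maps such as a derivation, a multiplication or Delta are carried past a substitution in this way,
  changing the substituted operator.\<close>

lemma op_subst_natural:
  assumes h: "complex_linear h" and T: "complex_linear T" and T': "complex_linear T'"
    and "\<And>v. h (T v) = T' (h v)"
  shows "h (op_subst T p) = op_subst T' (map_poly h p)"
  by (induction p)
    (simp_all add: complex_linear_0[OF h] map_poly_pCons_linear[OF h] op_subst_pCons[OF T]
      op_subst_pCons[OF T'] complex_linear_add[OF h] assms(4))

lemma op_subst_map_poly_add:
  assumes T: "complex_linear T" and f: "complex_linear f" and g: "complex_linear g"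
  shows "op_subst T (map_poly (\<lambda>z. f z + g z) p) =
    op_subst T (map_poly f p) + op_subst T (map_poly g p)"
  by (induction p)
    (simp_all add: map_poly_pCons_linear f g linear_add op_subst_pCons[OF T]
      complex_linear_add[OF T] algebra_simps)

lemma op_subst_map_poly_diff:
  assumes T: "complex_linear T" and f: "complex_linear f" and g: "complex_linear g"
  shows "op_subst T (map_poly (\<lambda>z. f z - g z) p) =
    op_subst T (map_poly f p) - op_subst T (map_poly g p)"
proof (induction p)
  case (pCons a p)
  then show ?case
    by (simp add: map_poly_pCons_linear f g linear_diff op_subst_pCons[OF T] complex_linear_diff[OF T])
qed simp

lemma op_subst_map_poly_scale:
  assumes T: "complex_linear T" and f: "complex_linear f"
  shows "op_subst T (map_poly (\<lambda>z. c *\<^sub>C f z) p) = c *\<^sub>C op_subst T (map_poly f p)"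
proof -
  have "complex_linear (\<lambda>z. c *\<^sub>C f z)"
    using f by (simp add: complex_linear_iff scaleC_add_right scaleC_scaleC mult.commute)
  then show ?thesis
    by (induction p)
      (simp_all add: map_poly_pCons_linear f op_subst_pCons[OF T]
        complex_linear_scale[OF T] scaleC_add_right)
qed

text \<open>The parameter \<open>z\<close> is the content of another tensor slot, which may itself
  be filled by a product.\<close>

lemma linear_op_subst_map_poly:
  assumes T: "complex_linear T"
    and \<phi>: "\<And>z. complex_linear (\<phi> z)" "\<And>w. complex_linear (\<lambda>z. \<phi> z w)"
  shows "complex_linear (\<lambda>z. op_subst T (map_poly (\<phi> z) q))"
proof -
  have "\<phi> (x + y) = (\<lambda>w. \<phi> x w + \<phi> y w)" "\<phi> (c *\<^sub>C x) = (\<lambda>w. c *\<^sub>C \<phi> x w)" for x y c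
    by (simp_all add: fun_eq_iff complex_linear_add[OF \<phi>(2)] complex_linear_scale[OF \<phi>(2)])
  then show ?thesis
    unfolding complex_linear_iff
    by (simp add: op_subst_map_poly_add[OF T \<phi>(1) \<phi>(1)] op_subst_map_poly_scale[OF T \<phi>(1)])
qed

text \<open>Both sides are the double sum of
  \<open>(T ^^ j) ((S ^^ k) (\<phi> (coeff p j) (coeff q k)))\<close>, up to the order of the
  commuting powers.\<close>

lemma op_subst_swap:
  fixes S T :: "'w::complex_vector \<Rightarrow> 'w"
  assumes S: "complex_linear S" and T: "complex_linear T"
    and c: "\<And>w. S (T w) = T (S w)"
    and \<phi>: "\<And>z. complex_linear (\<phi> z)" "\<And>w. complex_linear (\<lambda>z. \<phi> z w)"
  shows "op_subst T (map_poly (\<lambda>z. op_subst S (map_poly (\<phi> z) q)) p) =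
    op_subst S (map_poly (\<lambda>w. op_subst T (map_poly (\<lambda>z. \<phi> z w) p)) q)"
proof (induction p)
  case 0
  have "map_poly (\<lambda>w. 0) q = (0 :: 'w poly)"
    by (rule poly_eqI) (simp add: coeff_map_poly)
  then show ?case by simp
next
  case (pCons a p)
  let ?g = "\<lambda>w. op_subst T (map_poly (\<lambda>z. \<phi> z w) p)"
  have \<phi>': "complex_linear (\<lambda>z. op_subst S (map_poly (\<phi> z) q))" for q
    by (rule linear_op_subst_map_poly[OF S \<phi>])
  have g: "complex_linear ?g"
    by (rule linear_op_subst_map_poly[OF T \<phi>(2) \<phi>(1)])
  have "op_subst S (map_poly (\<lambda>w. op_subst T (map_poly (\<lambda>z. \<phi> z w) (pCons a p))) q) =
      op_subst S (map_poly (\<lambda>w. \<phi> a w + T (?g w)) q)"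
    by (simp add: map_poly_pCons_linear \<phi> op_subst_pCons[OF T])
  also have "\<dots> = op_subst S (map_poly (\<phi> a) q) + op_subst S (map_poly T (map_poly ?g q))"
    by (simp add: op_subst_map_poly_add[OF S \<phi>(1) linear_compose[OF T g]] map_poly_compose T g)
  also have "op_subst S (map_poly T (map_poly ?g q)) = T (op_subst S (map_poly ?g q))"
    by (rule op_subst_natural[symmetric]) (simp_all add: S T c)
  finally show ?case
    by (simp add: map_poly_pCons_linear \<phi>' op_subst_pCons[OF T] pCons.IH)
qed

text \<open>Evaluation at lambda = T carries multiplication by lambda to \<open>T\<close> and
  coefficientwise \<open>D\<close> to \<open>E\<close>, hence the operator -lambda - D to -T - E.
  This removes the shifted variable inside R(a).\<close>

lemma op_subst_neg_shift_subst:
  assumes T: "complex_linear T" and E: "complex_linear E" and D: "complex_linear D"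
    and \<psi>: "complex_linear \<psi>" "\<And>v. \<psi> (D v) = E (\<psi> v)"
    and c: "\<And>w. T (E w) = E (T w)"
  shows "op_subst T (map_poly \<psi> (neg_shift_subst D p)) =
    op_subst (\<lambda>w. - T w - E w) (map_poly \<psi> p)"
proof -
  let ?h = "\<lambda>q. op_subst T (map_poly \<psi> q)"
  have h: "complex_linear ?h" by (intro linear_intros T \<psi>)
  have hD: "?h (map_poly D q) = E (?h q)" for q
  proof -
    have "?h (map_poly D q) = op_subst T (map_poly E (map_poly \<psi> q))"
      by (simp add: map_poly_compose D E \<psi>)
    also have "\<dots> = E (?h q)"
      by (rule op_subst_natural[symmetric]) (simp_all add: T E c)
    finally show ?thesis .
  qed
  have "?h (neg_shift_subst D p) =
      op_subst (\<lambda>w. - T w - E w) (map_poly ?h (map_poly (\<lambda>v. [:v:]) p))"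
    unfolding neg_shift_subst_def
  proof (rule op_subst_natural[OF h])
    show "complex_linear (\<lambda>q. - pCons 0 q - map_poly D q)" by (intro linear_intros D)
    show "complex_linear (\<lambda>w. - T w - E w)" by (intro linear_intros T E)
    show "?h (- pCons 0 q - map_poly D q) = - T (?h q) - E (?h q)" for q
      by (simp add: complex_linear_diff[OF h] complex_linear_minus[OF h] hD
          map_poly_pCons_linear[OF \<psi>(1)] op_subst_pCons[OF T] complex_linear_0[OF \<psi>(1)]
          complex_linear_minus[OF T])
  qed
  also have "map_poly ?h (map_poly (\<lambda>v. [:v:]) p) = map_poly (\<lambda>v. ?h [:v:]) p"
    by (rule map_poly_compose) (intro linear_intros T \<psi>)+
  also have "\<dots> = map_poly \<psi> p"
    by (simp add: map_poly_pCons_linear[OF \<psi>(1)] op_subst_pCons[OF T] complex_linear_0[OF T])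
  finally show ?thesis .
qed

lemma linear_neg_shift_subst:
  "complex_linear D \<Longrightarrow> complex_linear f \<Longrightarrow> complex_linear (\<lambda>x. neg_shift_subst D (f x))"
  unfolding neg_shift_subst_def by (intro linear_intros)

lemma op_subst_id: "op_subst (pCons 0) (map_poly (\<lambda>v. [:v:]) p) = (p :: 'a::complex_vector poly)"
proof -
  have 1: "complex_linear (pCons 0 :: 'a poly \<Rightarrow> _)" using linear_pCons_0[OF linear_ident] .
  show ?thesis
    by (induction p) (simp_all add: op_subst_pCons[OF 1] map_poly_pCons)
qed

text \<open>An opaque name for multiplication by the variable: on \<^term>\<open>pCons 0 p + pCons 0 q\<close> the
  simplifier would collect the summands under one \<^term>\<open>pCons 0\<close>.\<close>

definition poly_shift :: "'v::zero poly \<Rightarrow> 'v poly"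
  where "poly_shift p = pCons 0 p"

lemma tensor_map_compose:
  assumes "complex_linear f" "complex_linear g" "complex_linear h" "complex_linear k"
  shows "tensor_map f g (tensor_map h k t) = tensor_map (\<lambda>x. f (h x)) (\<lambda>y. g (k y)) t"
  by (rule tensor_eqI[where t = t])
    (simp_all add: linear_intros tensor_map_elem linear_compose assms)

lemma linear_poly_shift: "complex_linear f \<Longrightarrow> complex_linear (\<lambda>x. poly_shift (f x))"
  unfolding poly_shift_def by (rule linear_pCons_0)

lemma map_poly_shift: "complex_linear f \<Longrightarrow> map_poly f (poly_shift p) = poly_shift (map_poly f p)"
  by (simp add: poly_shift_def map_poly_pCons_linear complex_linear_0)

lemma map_poly_const: "complex_linear f \<Longrightarrow> map_poly f [:v:] = [:f v:]"
  by (simp add: map_poly_pCons_linear)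

text \<open>Substituting the variable for itself changes nothing. Polynomial identities thus become
  identities between evaluated products with values in a space of polynomials, where lambda is one
  more commuting operator.\<close>

lemma map_poly_as_op_subst:
  assumes "complex_linear f"
  shows "map_poly f p = op_subst poly_shift (map_poly (\<lambda>v. [:f v:]) p)"
proof -
  have "map_poly f p = op_subst poly_shift (map_poly (\<lambda>v. [:v:]) (map_poly f p))"
    using op_subst_id[of "map_poly f p"] by (simp add: poly_shift_def[abs_def])
  also have "map_poly (\<lambda>v. [:v:]) (map_poly f p) = map_poly (\<lambda>v. [:f v:]) p"
    by (intro map_poly_compose linear_intros assms)
  finally show ?thesis .
qed

lemma neg_shift_subst_as_op_subst:
  assumes "complex_linear D" "complex_linear f"
  shows "neg_shift_subst D (map_poly f p) =
    op_subst (\<lambda>q. - poly_shift q - map_poly D q) (map_poly (\<lambda>v. [:f v:]) p)"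
  unfolding neg_shift_subst_def poly_shift_def
  by (subst map_poly_compose) (intro linear_intros assms refl)+

section \<open>Substitution into the product\<close>

context assoc_conformal_algebra
begin

text \<open>The image of \<open>a\<^sub>\<lambda> b\<close> under \<open>\<phi>\<close> with \<open>\<lambda>\<close> replaced by an operator \<open>T\<close> on the target. Nested products
  then involve several commuting operators on one space instead of polynomials in several
  variables.\<close>

definition sprod :: "('a \<Rightarrow> 'w::complex_vector) \<Rightarrow> ('w \<Rightarrow> 'w) \<Rightarrow> 'a \<Rightarrow> 'a \<Rightarrow> 'w"
  where "sprod \<phi> T a b = op_subst T (map_poly \<phi> (lprod a b))"

lemma linear_lprod_right: "complex_linear f \<Longrightarrow> complex_linear (\<lambda>x. lprod a (f x))"
  and linear_lprod_left: "complex_linear f \<Longrightarrow> complex_linear (\<lambda>x. lprod (f x) b)"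
  using bilinear_lprod by (simp_all add: complex_bilinear_iff complex_linear_iff)

lemma linear_sprod_right:
  "complex_linear \<phi> \<Longrightarrow> complex_linear T \<Longrightarrow> complex_linear f \<Longrightarrow>
    complex_linear (\<lambda>x. sprod \<phi> T a (f x))"
  unfolding sprod_def by (intro linear_intros linear_lprod_right)

lemma linear_sprod_left:
  "complex_linear \<phi> \<Longrightarrow> complex_linear T \<Longrightarrow> complex_linear f \<Longrightarrow>
    complex_linear (\<lambda>x. sprod \<phi> T (f x) b)"
  unfolding sprod_def by (intro linear_intros linear_lprod_left)

lemma linear_sprod_fun:
  "(\<And>z. complex_linear (\<phi> z)) \<Longrightarrow> (\<And>w. complex_linear (\<lambda>z. \<phi> z w)) \<Longrightarrow> complex_linear T \<Longrightarrow>
    complex_linear (\<lambda>z. sprod (\<phi> z) T a b)"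
  unfolding sprod_def by (rule linear_op_subst_map_poly)

lemmas sprod_linear_intros =
  linear_intros linear_D linear_lprod_left linear_lprod_right linear_neg_shift_subst
  linear_compose[OF linear_D] linear_sprod_right linear_sprod_left linear_sprod_fun

lemma sprod_D_left:
  "complex_linear \<phi> \<Longrightarrow> complex_linear T \<Longrightarrow> sprod \<phi> T (D a) b = - T (sprod \<phi> T a b)"
  by (simp add: sprod_def D_left complex_linear_minus[OF complex_linear_map_poly]
      complex_linear_minus[OF complex_linear_op_subst] map_poly_pCons_linear op_subst_pCons
      complex_linear_0 complex_linear_minus)

lemma sprod_diff:
  "complex_linear T \<Longrightarrow> complex_linear f \<Longrightarrow> complex_linear g \<Longrightarrow>
    sprod (\<lambda>z. f z - g z) T a b = sprod f T a b - sprod g T a b"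
  unfolding sprod_def by (rule op_subst_map_poly_diff)

lemma sprod_natural:
  assumes "complex_linear h" "complex_linear T" "complex_linear T'" "complex_linear \<phi>"
    and "\<And>v. h (T v) = T' (h v)"
  shows "h (sprod \<phi> T a b) = sprod (\<lambda>z. h (\<phi> z)) T' a b"
  unfolding sprod_def by (simp add: op_subst_natural[OF assms(1-3,5)] map_poly_compose assms)

text \<open>\<open>E\<close> is the derivation of the slot in which \<open>\<phi>\<close> puts the
  product, so this is the axiom with factor D + lambda, evaluated at lambda = T.\<close>

lemma sprod_D_right:
  assumes T: "complex_linear T" and E: "complex_linear E" and \<phi>: "complex_linear \<phi>"
    and \<phi>D: "\<And>x. \<phi> (D x) = E (\<phi> x)" and c: "\<And>w. T (E w) = E (T w)"
  shows "sprod \<phi> T a (D b) = E (sprod \<phi> T a b) + T (sprod \<phi> T a b)"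
proof -
  have "op_subst T (map_poly \<phi> (map_poly D p)) = E (op_subst T (map_poly \<phi> p))" for p
    by (simp add: op_subst_natural[OF E T T c[symmetric]] map_poly_compose linear_D E \<phi> \<phi>D)
  then show ?thesis
    by (simp add: sprod_def D_right complex_linear_add[OF complex_linear_map_poly[OF \<phi>]]
      complex_linear_add[OF complex_linear_op_subst[OF T]] map_poly_pCons_linear \<phi> op_subst_pCons T
      complex_linear_0[OF \<phi>])
qed

text \<open>Used for two products that sit in different tensor slots.\<close>

lemma sprod_swap:
  assumes "complex_linear S" "complex_linear T" "\<And>w. S (T w) = T (S w)"
    and "\<And>z. complex_linear (\<phi> z)" "\<And>w. complex_linear (\<lambda>z. \<phi> z w)"
  shows "sprod (\<lambda>z. sprod (\<phi> z) S c d) T a b = sprod (\<lambda>w. sprod (\<lambda>z. \<phi> z w) T a b) S c d"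
  unfolding sprod_def by (rule op_subst_swap[OF assms])

lemma sprod_assoc:
  assumes S: "complex_linear S" and T: "complex_linear T" and ST: "\<And>w. S (T w) = T (S w)"
    and \<phi>: "complex_linear \<phi>"
  shows "sprod (\<lambda>x. sprod \<phi> (\<lambda>w. S w + T w) x c) S a b = sprod (\<lambda>x. sprod \<phi> S a x) T b c"
proof -
  \<comment> \<open>\<open>?e\<close> evaluates the inner variable lambda at \<open>S\<close>, and
    \<open>?ev\<close> then the outer variable mu at \<open>T\<close>. The associativity axiom is
    pushed through \<open>?ev\<close>; commutation lets lambda, which acts on the coefficients, come
    out past the powers of \<open>T\<close>.\<close>
  let ?e = "\<lambda>q. op_subst S (map_poly \<phi> q)"
  let ?ev = "\<lambda>P. op_subst T (map_poly ?e P)"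
  note L = sprod_linear_intros S T \<phi>
  have e: "complex_linear ?e" by (intro L)
  have ev: "complex_linear ?ev" by (intro L)
  have e0: "?e (pCons 0 q) = S (?e q)" for q
    by (simp add: map_poly_pCons_linear \<phi> op_subst_pCons S complex_linear_0)
  have ev_mu: "?ev (pCons 0 P) = T (?ev P)" for P
    by (simp add: map_poly_pCons_linear[OF e] op_subst_pCons T complex_linear_0[OF S]
      complex_linear_0[OF \<phi>])
  have ev_lambda: "?ev (map_poly (pCons 0) P) = S (?ev P)" for P
  proof -
    have "?ev (map_poly (pCons 0) P) = op_subst T (map_poly (\<lambda>q. S (?e q)) P)"
      by (subst map_poly_compose) (simp_all only: e0, (intro L)+)
    also have "\<dots> = op_subst T (map_poly S (map_poly ?e P))"
      by (simp add: map_poly_compose S e)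
    also have "\<dots> = S (?ev P)"
      by (rule op_subst_natural[symmetric]) (simp_all add: S T ST)
    finally show ?thesis .
  qed
  have ev_const: "?ev [:[:z:]:] = \<phi> z" for z
    by (simp add: map_poly_pCons_linear e \<phi> op_subst_pCons S T complex_linear_0)
  have inner: "?ev (op_subst (\<lambda>q. map_poly (pCons 0) q + pCons 0 q) (map_poly (\<lambda>z. [:[:z:]:]) (lprod x c))) =
      sprod \<phi> (\<lambda>w. S w + T w) x c" for x
  proof -
    have "?ev (op_subst (\<lambda>q. map_poly (pCons 0) q + pCons 0 q) (map_poly (\<lambda>z. [:[:z:]:]) (lprod x c))) =
      op_subst (\<lambda>w. S w + T w) (map_poly ?ev (map_poly (\<lambda>z. [:[:z:]:]) (lprod x c)))"
      by (rule op_subst_natural[OF ev])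
        (simp_all only: complex_linear_add[OF ev] ev_mu ev_lambda, (intro L)+)
    also have "map_poly ?ev (map_poly (\<lambda>z. [:[:z:]:]) (lprod x c)) = map_poly \<phi> (lprod x c)"
      by (subst map_poly_compose[OF ev]) (simp_all only: ev_const, (intro L)+)
    finally show ?thesis by (simp add: sprod_def)
  qed
  have "sprod (\<lambda>x. sprod \<phi> S a x) T b c = ?ev (map_poly (lprod a) (lprod b c))"
    unfolding sprod_def by (subst map_poly_compose[OF e]) (intro L refl)+
  also have "\<dots> = ?ev (op_subst (map_poly (pCons 0))
         (map_poly
           (\<lambda>x. op_subst (\<lambda>q. map_poly (pCons 0) q + pCons 0 q) (map_poly (\<lambda>z. [:[:z:]:]) (lprod x c)))
           (lprod a b)))"
    by (simp only: assoc)
  also have "\<dots> = op_subst S (map_poly ?ev (map_poly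
           (\<lambda>x. op_subst (\<lambda>q. map_poly (pCons 0) q + pCons 0 q) (map_poly (\<lambda>z. [:[:z:]:]) (lprod x c)))
           (lprod a b)))"
    by (rule op_subst_natural[OF ev]) (simp_all only: ev_lambda, (intro L)+)
  also have "\<dots> = sprod (\<lambda>x. sprod \<phi> (\<lambda>w. S w + T w) x c) S a b"
    unfolding sprod_def[of _ S a b]
    by (subst map_poly_compose[OF ev]) (simp_all only: inner, (intro L)+)
  finally show ?thesis ..
qed

section \<open>Derivations of the single factors on two and three tensor factors\<close>

abbreviation d1 :: "'a \<otimes> 'a \<Rightarrow> 'a \<otimes> 'a" where "d1 \<equiv> tensor_map D id"
abbreviation d2 :: "'a \<otimes> 'a \<Rightarrow> 'a \<otimes> 'a" where "d2 \<equiv> tensor_map id D"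
abbreviation e1 :: "'a \<otimes> 'a \<otimes> 'a \<Rightarrow> 'a \<otimes> 'a \<otimes> 'a" where "e1 \<equiv> tensor_map D id"
abbreviation e2 :: "'a \<otimes> 'a \<otimes> 'a \<Rightarrow> 'a \<otimes> 'a \<otimes> 'a" where "e2 \<equiv> tensor_map id d1"
abbreviation e3 :: "'a \<otimes> 'a \<otimes> 'a \<Rightarrow> 'a \<otimes> 'a \<otimes> 'a" where "e3 \<equiv> tensor_map id d2"

lemma operator_linear:
  "complex_linear d1" "complex_linear d2" "complex_linear e1" "complex_linear e2" "complex_linear e3"
  "complex_linear (map_poly d1)" "complex_linear (map_poly d2)"
  "complex_linear (poly_shift :: ('a \<otimes> 'a) poly \<Rightarrow> _)"
  by (rule complex_linear_tensor_map complex_linear_map_poly linear_poly_shift[OF linear_ident])+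

lemmas operator_additive =
  operator_linear[THEN complex_linear_add] operator_linear[THEN complex_linear_minus]
  operator_linear[THEN complex_linear_diff]

lemma operator_elem:
  "d1 (x \<otimes> y) = D x \<otimes> y" "d2 (x \<otimes> y) = x \<otimes> D y"
  "e1 (x \<otimes> t) = D x \<otimes> t" "e2 (x \<otimes> t) = x \<otimes> d1 t" "e3 (x \<otimes> t) = x \<otimes> d2 t"
  by (simp_all add: tensor_map_elem linear_D linear_id operator_linear)

text \<open>Oriented to bring words of operators into a normal order: \<open>poly_shift\<close>
  outermost, then increasing index. As rewrite rules they terminate.\<close>

lemma operator_commute:
  "d2 (d1 t) = d1 (d2 t)"
  "e2 (e1 s) = e1 (e2 s)" "e3 (e1 s) = e1 (e3 s)" "e3 (e2 s) = e2 (e3 s)"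
  "map_poly d2 (map_poly d1 p) = map_poly d1 (map_poly d2 p)"
  "map_poly d1 (poly_shift p) = poly_shift (map_poly d1 p)"
  "map_poly d2 (poly_shift p) = poly_shift (map_poly d2 p)"
  by (simp_all add: tensor_map_compose linear_D linear_id operator_linear map_poly_compose map_poly_shift)

lemmas operator_simps = operator_additive operator_commute

lemma tensor_D2_eq: "tensor_D2 D = (\<lambda>t. d1 t + d2 t)"
  by (simp add: fun_eq_iff tensor_D2_def)

lemma tensor_D3_eq: "tensor_D3 D = (\<lambda>t. e1 t + e2 t + e3 t)"
  by (simp add: fun_eq_iff tensor_D3_def)

lemma map_poly_tensor_D2: "map_poly (tensor_D2 D) p = map_poly d1 p + map_poly d2 p"
  unfolding tensor_D2_eq
  by (rule poly_eqI) (simp add: coeff_map_poly operator_linear complex_linear_0)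

lemmas op_linear_intros = operator_linear sprod_linear_intros linear_poly_shift

section \<open>The coboundary as a difference of evaluated products\<close>

lemma linear_coboundary: "complex_linear f \<Longrightarrow> complex_linear (\<lambda>x. coboundary D lprod (f x) a)"
  unfolding coboundary_def by (intro op_linear_intros)

lemma linear_right_mult: "complex_linear (right_mult D lprod a)"
  unfolding right_mult_def[abs_def] by (intro op_linear_intros)

lemma linear_lprod: "complex_linear (lprod a)"
  by (rule linear_lprod_right[OF linear_ident])

text \<open>In R(a)_lambda the variable is -lambda - d1 on the first slot, and at lambda = -d1 - d2
  this is just \<open>d2\<close>.\<close>

lemma coboundary_elem:
  "coboundary D lprod (x \<otimes> y) a =
    sprod (\<lambda>z. x \<otimes> z) (\<lambda>t. - tensor_D2 D t) a y - sprod (\<lambda>z. z \<otimes> y) d2 x a"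
proof -
  let ?T = "\<lambda>t. - tensor_D2 D t"
  have T: "complex_linear ?T" by (intro op_linear_intros)
  have "op_subst ?T (map_poly (\<lambda>z. z \<otimes> y) (neg_shift_subst D (lprod x a))) =
      op_subst (\<lambda>w. - ?T w - d1 w) (map_poly (\<lambda>z. z \<otimes> y) (lprod x a))"
    by (rule op_subst_neg_shift_subst[OF T])
      (simp_all add: op_linear_intros operator_elem tensor_D2_eq operator_simps)
  also have "(\<lambda>w. - ?T w - d1 w) = d2" by (simp add: tensor_D2_eq)
  finally show ?thesis
    by (simp add: coboundary_def sprod_def tensor_poly_right_elem tensor_poly_left_elem
      linear_right_mult linear_lprod complex_linear_diff[OF complex_linear_op_subst[OF T]] right_mult_def)
qed

text \<open>In the definition \<open>a\<close> occurs inside the function given to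
  \<open>tensor_lift\<close>; its linearity becomes visible only on elementary tensors, hence the
  induction on \<open>r\<close>.\<close>

lemma linear_coboundary_right: "complex_linear (coboundary D lprod r)"
proof (induction r rule: tensor_induct)
  case zero
  have "coboundary D lprod 0 = (\<lambda>a. 0)"
    using complex_linear_0[OF linear_coboundary[OF linear_ident]] by auto
  then show ?case by (simp add: complex_linear_iff)
next
  case (add x y t)
  have "coboundary D lprod (x \<otimes> y + t) = (\<lambda>a. sprod (\<lambda>z. x \<otimes> z) (\<lambda>t. - tensor_D2 D t) a y
      - sprod (\<lambda>z. z \<otimes> y) d2 x a + coboundary D lprod t a)"
    by (simp add: fun_eq_iff complex_linear_add[OF linear_coboundary[OF linear_ident]] coboundary_elem)
  then show ?case
    by (simp only:) (intro op_linear_intros add)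
qed

text \<open>Each of the two terms produces d1 + d2 separately. In the first, \<open>D a\<close> is
  the left argument of a product at -d1 - d2 and gives minus that operator; in the second it is the
  right argument of a product at \<open>d2\<close> in slot 1 and gives d1 + d2.\<close>

lemma coboundary_D: "coboundary D lprod r (D a) = tensor_D2 D (coboundary D lprod r a)"
proof (rule tensor_eqI[where t = r])
  let ?T = "\<lambda>t. - d1 t - d2 t"
  have T: "complex_linear ?T" by (intro op_linear_intros)
  have l: "complex_linear ((\<otimes>) x)" "complex_linear (\<lambda>z. z \<otimes> y)" for x y :: 'a
    by (intro op_linear_intros)+
  show "coboundary D lprod (x \<otimes> y) (D a) = tensor_D2 D (coboundary D lprod (x \<otimes> y) a)" for x y
    unfolding coboundary_elem
    by (simp add: sprod_D_left T l
      sprod_D_right[where E=d1] operator_linear operator_elem operator_simps tensor_D2_eq)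
qed (intro op_linear_intros linear_coboundary)+

section \<open>Coassociativity\<close>

text \<open>Slot 2 is split into slots 2 and 3 by Delta, and by \<open>coboundary_D\<close> its
  derivation becomes the derivation of both.\<close>

lemma tensor_map_coboundary_intertwine:
  "tensor_map id (coboundary D lprod s) (d1 t) = e1 (tensor_map id (coboundary D lprod s) t)"
  "tensor_map id (coboundary D lprod s) (d2 t) =
    e2 (tensor_map id (coboundary D lprod s) t) + e3 (tensor_map id (coboundary D lprod s) t)"
proof -
  note [simp] = linear_coboundary_right linear_id linear_D operator_linear
  show "tensor_map id (coboundary D lprod s) (d1 t) = e1 (tensor_map id (coboundary D lprod s) t)"
    by (simp add: tensor_map_compose)
  show "tensor_map id (coboundary D lprod s) (d2 t) =
    e2 (tensor_map id (coboundary D lprod s) t) + e3 (tensor_map id (coboundary D lprod s) t)"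
    by (rule tensor_eqI[where t = t])
      (simp_all add: op_linear_intros tensor_map_elem coboundary_D tensor_D2_eq
        elem_tensor_add_right flip: id_def)
qed

lemma tensor_assoc_intertwine:
  "tensor_assoc (d1 u \<otimes> z) = e1 (tensor_assoc (u \<otimes> z))"
  "tensor_assoc (d2 u \<otimes> z) = e2 (tensor_assoc (u \<otimes> z))"
  "tensor_assoc (u \<otimes> D z) = e3 (tensor_assoc (u \<otimes> z))"
  by (rule tensor_eqI[where t = u]; simp add: op_linear_intros tensor_map_elem tensor_assoc_elem)+

lemma tensor_assoc_coboundary_intertwine:
  fixes t s
  defines "h \<equiv> \<lambda>t. tensor_assoc (tensor_map (coboundary D lprod s) id t)"
  shows "h (d1 t) = e1 (h t) + e2 (h t)" "h (d2 t) = e3 (h t)"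
proof -
  note [simp] = linear_coboundary_right linear_id linear_D operator_linear
  show "h (d1 t) = e1 (h t) + e2 (h t)" unfolding h_def
    by (rule tensor_eqI[where t = t])
      (simp_all add: op_linear_intros tensor_map_elem coboundary_D tensor_D2_eq elem_tensor_add_left
        tensor_assoc_intertwine complex_linear_add[OF linear_tensor_assoc[OF linear_ident]]
        flip: id_def)
  show "h (d2 t) = e3 (h t)" unfolding h_def
    by (rule tensor_eqI[where t = t])
      (simp_all add: op_linear_intros tensor_map_elem tensor_assoc_intertwine flip: id_def)
qed

lemma elem_coboundary_elem:
  "x \<otimes> coboundary D lprod (u \<otimes> v) z =
    sprod (\<lambda>w. x \<otimes> u \<otimes> w) (\<lambda>t. - e2 t - e3 t) z v - sprod (\<lambda>w. x \<otimes> w \<otimes> v) e3 u z"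
proof -
  have h: "complex_linear (\<lambda>t. x \<otimes> t)" by (intro linear_intros)
  have "x \<otimes> sprod (\<lambda>z. u \<otimes> z) (\<lambda>t. - tensor_D2 D t) z v =
      sprod (\<lambda>w. x \<otimes> u \<otimes> w) (\<lambda>t. - e2 t - e3 t) z v"
    by (rule sprod_natural[OF h])
      (simp_all add: op_linear_intros tensor_D2_eq operator_elem complex_linear_diff[OF h]
        complex_linear_minus[OF h])
  moreover have "x \<otimes> sprod (\<lambda>z. z \<otimes> v) d2 u z = sprod (\<lambda>w. x \<otimes> w \<otimes> v) e3 u z"
    by (rule sprod_natural[OF h]) (simp_all add: op_linear_intros operator_elem)
  ultimately show ?thesis
    by (simp add: coboundary_elem complex_linear_diff[OF h])
qed

lemma tensor_assoc_coboundary_elem: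
  "tensor_assoc (coboundary D lprod (x \<otimes> y) z \<otimes> v) =
    sprod (\<lambda>w. x \<otimes> w \<otimes> v) (\<lambda>t. - e1 t - e2 t) z y - sprod (\<lambda>w. w \<otimes> y \<otimes> v) e2 x z"
proof -
  have h: "complex_linear (\<lambda>t :: 'a \<otimes> 'a. tensor_assoc (t \<otimes> v))" by (intro linear_intros)
  have "tensor_assoc (sprod (\<lambda>z. x \<otimes> z) (\<lambda>t. - tensor_D2 D t) z y \<otimes> v) =
      sprod (\<lambda>w. tensor_assoc ((x \<otimes> w) \<otimes> v)) (\<lambda>t. - e1 t - e2 t) z y"
    by (rule sprod_natural[OF h])
      (simp_all add: op_linear_intros tensor_D2_eq tensor_assoc_intertwine complex_linear_diff[OF h]
        complex_linear_minus[OF h])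
  moreover have "tensor_assoc (sprod (\<lambda>z. z \<otimes> y) d2 x z \<otimes> v) =
      sprod (\<lambda>w. tensor_assoc ((w \<otimes> y) \<otimes> v)) e2 x z"
    by (rule sprod_natural[OF h]) (simp_all add: op_linear_intros tensor_assoc_intertwine)
  ultimately show ?thesis
    by (simp add: coboundary_elem complex_linear_diff[OF h] tensor_assoc_elem)
qed

text \<open>The inner lines come from Delta of \<open>u \<otimes> v\<close> in slots 2 and 3. The
  outer operators -d1 - d2 and d2 of Delta of \<open>x \<otimes> y\<close> become -S and e2 + e3 on
  passing through \<open>?h\<close>.\<close>

lemma tensor_map_coboundary_elem:
  "tensor_map id (coboundary D lprod (u \<otimes> v)) (coboundary D lprod (x \<otimes> y) a) =
    sprod (\<lambda>z. sprod (\<lambda>w. x \<otimes> u \<otimes> w) (\<lambda>t. - e2 t - e3 t) z v) (\<lambda>t. - tensor_D3 D t) a y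
  - sprod (\<lambda>z. sprod (\<lambda>w. x \<otimes> w \<otimes> v) e3 u z) (\<lambda>t. - tensor_D3 D t) a y
  - sprod (\<lambda>z. sprod (\<lambda>w. z \<otimes> u \<otimes> w) (\<lambda>t. - e2 t - e3 t) y v) (\<lambda>t. e2 t + e3 t) x a
  + sprod (\<lambda>z. sprod (\<lambda>w. z \<otimes> w \<otimes> v) e3 u y) (\<lambda>t. e2 t + e3 t) x a"
proof -
  let ?h = "tensor_map id (coboundary D lprod (u \<otimes> v))"
  note L = op_linear_intros linear_coboundary_right linear_compose[OF linear_coboundary_right]
  have h: "complex_linear ?h" by (rule complex_linear_tensor_map)
  have h_elem: "?h (x \<otimes> z) = x \<otimes> coboundary D lprod (u \<otimes> v) z" for x z
    by (simp add: tensor_map_elem linear_id linear_coboundary_right)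
  have "?h (sprod (\<lambda>z. x \<otimes> z) (\<lambda>t. - tensor_D2 D t) a y) =
      sprod (\<lambda>z. ?h (x \<otimes> z)) (\<lambda>t. - tensor_D3 D t) a y"
    by (rule sprod_natural[OF h])
      (simp_all add: L tensor_D2_eq tensor_D3_eq complex_linear_diff[OF h]
        complex_linear_minus[OF h] tensor_map_coboundary_intertwine)
  moreover have "?h (sprod (\<lambda>z. z \<otimes> y) d2 x a) =
      sprod (\<lambda>z. ?h (z \<otimes> y)) (\<lambda>t. e2 t + e3 t) x a"
    by (rule sprod_natural[OF h]) (simp_all add: L tensor_map_coboundary_intertwine)
  ultimately show ?thesis
    by (simp add: coboundary_elem[of x y] complex_linear_diff[OF h] h_elem elem_coboundary_elem sprod_diff L)
qed

text \<open>Here \<open>u \<otimes> v\<close> is applied first and \<open>x \<otimes> y\<close>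
  second, the reverse of the other composite. In both, \<open>x\<close> then heads slot 1 and
  \<open>v\<close> ends slot 3, as in the summand of r . r.\<close>

lemma tensor_assoc_map_coboundary_elem:
  "tensor_assoc (tensor_map (coboundary D lprod (x \<otimes> y)) id (coboundary D lprod (u \<otimes> v) a)) =
    sprod (\<lambda>z. sprod (\<lambda>w. x \<otimes> w \<otimes> z) (\<lambda>t. - e1 t - e2 t) u y) (\<lambda>t. - tensor_D3 D t) a v
  - sprod (\<lambda>z. sprod (\<lambda>w. w \<otimes> y \<otimes> z) e2 x u) (\<lambda>t. - tensor_D3 D t) a v
  - sprod (\<lambda>z. sprod (\<lambda>w. x \<otimes> w \<otimes> v) (\<lambda>t. - e1 t - e2 t) z y) e3 u a
  + sprod (\<lambda>z. sprod (\<lambda>w. w \<otimes> y \<otimes> v) e2 x z) e3 u a"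
proof -
  let ?h = "\<lambda>t. tensor_assoc (tensor_map (coboundary D lprod (x \<otimes> y)) id t)"
  note L = op_linear_intros linear_coboundary_right linear_compose[OF linear_coboundary_right]
  have h: "complex_linear ?h" by (intro L)
  have h_elem: "?h (z \<otimes> v) = tensor_assoc (coboundary D lprod (x \<otimes> y) z \<otimes> v)" for v z
    by (simp add: tensor_map_elem linear_id linear_coboundary_right)
  have "?h (sprod (\<lambda>z. u \<otimes> z) (\<lambda>t. - tensor_D2 D t) a v) =
      sprod (\<lambda>z. ?h (u \<otimes> z)) (\<lambda>t. - tensor_D3 D t) a v"
    by (rule sprod_natural[OF h])
      (simp_all add: L tensor_D2_eq tensor_D3_eq complex_linear_diff[OF h]
        complex_linear_minus[OF h] tensor_assoc_coboundary_intertwine)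
  moreover have "?h (sprod (\<lambda>z. z \<otimes> v) d2 u a) = sprod (\<lambda>z. ?h (z \<otimes> v)) e3 u a"
    by (rule sprod_natural[OF h]) (simp_all add: L tensor_assoc_coboundary_intertwine)
  ultimately show ?thesis
    by (simp add: coboundary_elem[of u v] complex_linear_diff[OF h] h_elem tensor_assoc_coboundary_elem
      sprod_diff L)
qed

text \<open>The operators \<open>I \<otimes> I \<otimes> L\<^sub>A(a)\<close> and \<open>R\<^sub>A(a) \<otimes> I \<otimes> I\<close> at \<open>\<lambda> = -\<partial>\<^sup>\<otimes>\<^sup>3\<close>. For the second one,
  \<open>R\<^sub>A(a)\<^sub>\<lambda> x = x\<^bsub>-\<lambda>-\<partial>\<^esub> a\<close> becomes \<open>x\<^sub>\<nu> a\<close> with \<open>\<nu> = 1 \<otimes> \<partial> \<otimes> 1 + 1 \<otimes> 1 \<otimes> \<partial>\<close>.\<close>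

definition left_act :: "'a \<Rightarrow> 'a \<otimes> 'a \<otimes> 'a \<Rightarrow> 'a \<otimes> 'a \<otimes> 'a"
  where "left_act a t = op_subst (\<lambda>t. - tensor_D3 D t) (tensor_poly_right (tensor_poly_right (lprod a)) t)"

definition right_act :: "'a \<Rightarrow> 'a \<otimes> 'a \<otimes> 'a \<Rightarrow> 'a \<otimes> 'a \<otimes> 'a"
  where "right_act a t = op_subst (\<lambda>t. e2 t + e3 t) (tensor_poly_left (\<lambda>x. lprod x a) t)"

lemma linear_left_act: "complex_linear f \<Longrightarrow> complex_linear (\<lambda>x. left_act a (f x))"
  unfolding left_act_def by (intro op_linear_intros)

lemma linear_right_act: "complex_linear f \<Longrightarrow> complex_linear (\<lambda>x. right_act a (f x))"
  unfolding right_act_def by (intro op_linear_intros)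

lemma left_act_elem: "left_act a (p \<otimes> q \<otimes> z) = sprod (\<lambda>w. p \<otimes> q \<otimes> w) (\<lambda>t. - tensor_D3 D t) a z"
proof -
  have 1: "complex_linear (tensor_poly_right (lprod a) :: 'a \<otimes> 'a \<Rightarrow> _)"
    by (rule linear_tensor_poly_right[OF linear_ident])
  have 2: "map_poly (\<lambda>z. p \<otimes> z) (map_poly (\<lambda>z. q \<otimes> z) P) = map_poly (\<lambda>z. p \<otimes> q \<otimes> z) P" for P :: "'a poly"
    by (intro map_poly_compose linear_intros)
  show ?thesis
    unfolding left_act_def sprod_def tensor_poly_right_elem[OF 1] tensor_poly_right_elem[OF linear_lprod] 2 ..
qed

lemma right_act_elem: "right_act a (p \<otimes> t) = sprod (\<lambda>w. w \<otimes> t) (\<lambda>t. e2 t + e3 t) p a"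
  unfolding right_act_def sprod_def by (subst tensor_poly_left_elem) (intro op_linear_intros refl)+

text \<open>\<open>a\<close> multiplies slot 3 at lambda = -S, so only e3 is changed, by adding
  lambda.\<close>

lemma left_act_intertwine:
  "left_act a (e1 t) = e1 (left_act a t)"
  "left_act a (e2 t) = e2 (left_act a t)"
  "left_act a (e3 t) = e3 (left_act a t) - tensor_D3 D (left_act a t)"
proof -
  let ?N = "\<lambda>t. - tensor_D3 D t"
  note L = op_linear_intros linear_left_act
  have N: "complex_linear ?N" by (intro L)
  have "e1 (left_act a (p \<otimes> q \<otimes> z)) = left_act a (e1 (p \<otimes> q \<otimes> z))" for p q z
    unfolding operator_elem left_act_elem
    by (subst sprod_natural[where h = e1 and T' = ?N]) (simp_all add: L N operator_elem tensor_D3_eq operator_simps)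
  then show "left_act a (e1 t) = e1 (left_act a t)"
    by - (rule tensor3_eqI[where t = t], (intro L)+, metis)
  have "e2 (left_act a (p \<otimes> q \<otimes> z)) = left_act a (e2 (p \<otimes> q \<otimes> z))" for p q z
    unfolding operator_elem left_act_elem
    by (subst sprod_natural[where h = e2 and T' = ?N]) (simp_all add: L N operator_elem tensor_D3_eq operator_simps)
  then show "left_act a (e2 t) = e2 (left_act a t)"
    by - (rule tensor3_eqI[where t = t], (intro L)+, metis)
  have "left_act a (e3 (p \<otimes> q \<otimes> z)) = e3 (left_act a (p \<otimes> q \<otimes> z)) - tensor_D3 D (left_act a (p \<otimes> q \<otimes> z))"
    for p q z
    unfolding operator_elem left_act_elem
    by (subst sprod_D_right[where E = e3]) (simp_all add: L operator_elem tensor_D3_eq operator_simps)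
  then show "left_act a (e3 t) = e3 (left_act a t) - tensor_D3 D (left_act a t)"
    by - (rule tensor3_eqI[where t = t], (intro L)+, metis)
qed

text \<open>Slot 1 is the left argument of a product at e2 + e3, so its derivation becomes minus
  that operator.\<close>

lemma right_act_intertwine:
  "right_act a (e1 t) = - e2 (right_act a t) - e3 (right_act a t)"
  "right_act a (e2 t) = e2 (right_act a t)"
  "right_act a (e3 t) = e3 (right_act a t)"
proof -
  let ?E = "\<lambda>t. e2 t + e3 t"
  note L = op_linear_intros linear_right_act
  have E: "complex_linear ?E" by (intro L)
  have "right_act a (e1 (p \<otimes> s)) = - e2 (right_act a (p \<otimes> s)) - e3 (right_act a (p \<otimes> s))" for p s
    by (simp add: L operator_elem right_act_elem sprod_D_left)
  then show "right_act a (e1 t) = - e2 (right_act a t) - e3 (right_act a t)"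
    by - (rule tensor_eqI[where t = t], (intro L)+, metis)
  have "e2 (right_act a (p \<otimes> s)) = right_act a (e2 (p \<otimes> s))" for p s
    unfolding operator_elem right_act_elem
    by (subst sprod_natural[where h = e2 and T' = ?E]) (simp_all add: L E operator_elem operator_simps)
  then show "right_act a (e2 t) = e2 (right_act a t)"
    by - (rule tensor_eqI[where t = t], (intro L)+, metis)
  have "e3 (right_act a (p \<otimes> s)) = right_act a (e3 (p \<otimes> s))" for p s
    unfolding operator_elem right_act_elem
    by (subst sprod_natural[where h = e3 and T' = ?E]) (simp_all add: L E operator_elem operator_simps)
  then show "right_act a (e3 t) = e3 (right_act a t)"
    by - (rule tensor_eqI[where t = t], (intro L)+, metis)
qed

lemma left_act_tensor_D3: "left_act a (tensor_D3 D t) = 0"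
  by (simp add: tensor_D3_eq complex_linear_add[OF linear_left_act[OF linear_ident]] left_act_intertwine)

lemma right_act_tensor_D3: "right_act a (tensor_D3 D t) = 0"
  by (simp add: tensor_D3_eq complex_linear_add[OF linear_right_act[OF linear_ident]] right_act_intertwine)

section \<open>The two actions on r . r and the coassociativity defect\<close>

lemma bullet_summand_eq:
  "bullet_summand D lprod x y u v =
    sprod (\<lambda>z. x \<otimes> u \<otimes> z) e1 y v - sprod (\<lambda>z. x \<otimes> z \<otimes> v) (\<lambda>t. - e1 t - e2 t) u y
    + sprod (\<lambda>z. z \<otimes> y \<otimes> v) e2 x u"
  by (simp add: bullet_summand_def sprod_def)

text \<open>Only in the first term does \<open>a\<close> meet a slot that already holds a product, y
  v; associativity reassociates it at -S and e1, whose sum is -e2 - e3. In the other two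
  \<open>a\<close> meets \<open>v\<close> alone and the evaluations are interchanged.\<close>

lemma left_act_bullet_summand:
  "left_act a (bullet_summand D lprod x y u v) =
    sprod (\<lambda>z. sprod (\<lambda>w. x \<otimes> u \<otimes> w) (\<lambda>t. - e2 t - e3 t) z v) (\<lambda>t. - tensor_D3 D t) a y
  - sprod (\<lambda>z. sprod (\<lambda>w. x \<otimes> w \<otimes> z) (\<lambda>t. - e1 t - e2 t) u y) (\<lambda>t. - tensor_D3 D t) a v
  + sprod (\<lambda>z. sprod (\<lambda>w. w \<otimes> y \<otimes> z) e2 x u) (\<lambda>t. - tensor_D3 D t) a v"
proof -
  let ?N = "\<lambda>t. - tensor_D3 D t" and ?K = "left_act a"
  note L = op_linear_intros linear_left_act
  have K: "complex_linear ?K" by (rule linear_left_act[OF linear_ident])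
  have N: "complex_linear ?N" by (intro L)
  have "?K (sprod (\<lambda>z. x \<otimes> u \<otimes> z) e1 y v) = sprod (\<lambda>z. ?K (x \<otimes> u \<otimes> z)) e1 y v"
    by (rule sprod_natural[OF K]) (simp_all add: L left_act_intertwine)
  also have "\<dots> = sprod (\<lambda>z. sprod (\<lambda>w. x \<otimes> u \<otimes> w) (\<lambda>w. ?N w + e1 w) z v) ?N a y"
    unfolding left_act_elem
    by (rule sprod_assoc[symmetric]) (simp_all add: L tensor_D3_eq operator_simps)
  also have "(\<lambda>w. ?N w + e1 w) = (\<lambda>t. - e2 t - e3 t)" by (simp add: tensor_D3_eq)
  finally have 1: "?K (sprod (\<lambda>z. x \<otimes> u \<otimes> z) e1 y v) =
    sprod (\<lambda>z. sprod (\<lambda>w. x \<otimes> u \<otimes> w) (\<lambda>t. - e2 t - e3 t) z v) ?N a y" .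
  have "?K (sprod (\<lambda>z. x \<otimes> z \<otimes> v) (\<lambda>t. - e1 t - e2 t) u y) =
      sprod (\<lambda>z. ?K (x \<otimes> z \<otimes> v)) (\<lambda>t. - e1 t - e2 t) u y"
    by (rule sprod_natural[OF K]) (simp_all add: L left_act_intertwine
      complex_linear_diff[OF K] complex_linear_minus[OF K])
  also have "\<dots> = sprod (\<lambda>z. sprod (\<lambda>w. x \<otimes> w \<otimes> z) (\<lambda>t. - e1 t - e2 t) u y) ?N a v"
    unfolding left_act_elem
    by (rule sprod_swap) (simp_all add: L tensor_D3_eq operator_simps)
  finally have 2: "?K (sprod (\<lambda>z. x \<otimes> z \<otimes> v) (\<lambda>t. - e1 t - e2 t) u y) =
    sprod (\<lambda>z. sprod (\<lambda>w. x \<otimes> w \<otimes> z) (\<lambda>t. - e1 t - e2 t) u y) ?N a v" .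
  have "?K (sprod (\<lambda>z. z \<otimes> y \<otimes> v) e2 x u) = sprod (\<lambda>z. ?K (z \<otimes> y \<otimes> v)) e2 x u"
    by (rule sprod_natural[OF K]) (simp_all add: L left_act_intertwine)
  also have "\<dots> = sprod (\<lambda>z. sprod (\<lambda>w. w \<otimes> y \<otimes> z) e2 x u) ?N a v"
    unfolding left_act_elem
    by (rule sprod_swap) (simp_all add: L tensor_D3_eq operator_simps)
  finally show ?thesis
    by (simp add: bullet_summand_eq complex_linear_add[OF K] complex_linear_diff[OF K] 1 2)
qed

text \<open>Moving the action inside replaces e1 by -e2 - e3, so -e1 - e2 turns into e3.
  Associativity is needed only in the third term, where slot 1 holds x u.\<close>

lemma right_act_bullet_summand:
  "right_act a (bullet_summand D lprod x y u v) =
    sprod (\<lambda>z. sprod (\<lambda>w. z \<otimes> u \<otimes> w) (\<lambda>t. - e2 t - e3 t) y v) (\<lambda>t. e2 t + e3 t) x a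
  - sprod (\<lambda>z. sprod (\<lambda>w. z \<otimes> w \<otimes> v) e3 u y) (\<lambda>t. e2 t + e3 t) x a
  + sprod (\<lambda>z. sprod (\<lambda>w. w \<otimes> y \<otimes> v) e2 x z) e3 u a"
proof -
  let ?E = "\<lambda>t. e2 t + e3 t" and ?K = "right_act a"
  note L = op_linear_intros linear_right_act
  have K: "complex_linear ?K" by (rule linear_right_act[OF linear_ident])
  have "?K (sprod (\<lambda>z. x \<otimes> u \<otimes> z) e1 y v) = sprod (\<lambda>z. ?K (x \<otimes> u \<otimes> z)) (\<lambda>t. - e2 t - e3 t) y v"
    by (rule sprod_natural[OF K]) (simp_all add: L right_act_intertwine)
  also have "\<dots> = sprod (\<lambda>z. sprod (\<lambda>w. z \<otimes> u \<otimes> w) (\<lambda>t. - e2 t - e3 t) y v) ?E x a"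
    unfolding right_act_elem
    by (rule sprod_swap) (simp_all add: L operator_simps)
  finally have 1: "?K (sprod (\<lambda>z. x \<otimes> u \<otimes> z) e1 y v) =
    sprod (\<lambda>z. sprod (\<lambda>w. z \<otimes> u \<otimes> w) (\<lambda>t. - e2 t - e3 t) y v) ?E x a" .
  have "?K (sprod (\<lambda>z. x \<otimes> z \<otimes> v) (\<lambda>t. - e1 t - e2 t) u y) = sprod (\<lambda>z. ?K (x \<otimes> z \<otimes> v)) e3 u y"
    by (rule sprod_natural[OF K]) (simp_all add: L right_act_intertwine
      complex_linear_diff[OF K] complex_linear_minus[OF K])
  also have "\<dots> = sprod (\<lambda>z. sprod (\<lambda>w. z \<otimes> w \<otimes> v) e3 u y) ?E x a"
    unfolding right_act_elem
    by (rule sprod_swap) (simp_all add: L operator_simps)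
  finally have 2: "?K (sprod (\<lambda>z. x \<otimes> z \<otimes> v) (\<lambda>t. - e1 t - e2 t) u y) =
    sprod (\<lambda>z. sprod (\<lambda>w. z \<otimes> w \<otimes> v) e3 u y) ?E x a" .
  have "?K (sprod (\<lambda>z. z \<otimes> y \<otimes> v) e2 x u) = sprod (\<lambda>z. ?K (z \<otimes> y \<otimes> v)) e2 x u"
    by (rule sprod_natural[OF K]) (simp_all add: L right_act_intertwine)
  also have "\<dots> = sprod (\<lambda>z. sprod (\<lambda>w. w \<otimes> y \<otimes> v) e2 x z) e3 u a"
    unfolding right_act_elem
    by (rule sprod_assoc) (simp_all add: L operator_simps)
  finally show ?thesis
    by (simp add: bullet_summand_eq complex_linear_add[OF K] complex_linear_diff[OF K] 1 2)
qed

lemma coassoc_defect_elem: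
  "tensor_map id (coboundary D lprod (u \<otimes> v)) (coboundary D lprod (x \<otimes> y) a) -
    tensor_assoc (tensor_map (coboundary D lprod (x \<otimes> y)) id (coboundary D lprod (u \<otimes> v) a)) =
    left_act a (bullet_summand D lprod x y u v) - right_act a (bullet_summand D lprod x y u v)"
proof -
  \<comment> \<open>The two terms with \<open>a\<close> in the middle slot, (ua)y and u(ay), which
    no term of r . r produces: they cancel.\<close>
  have "sprod (\<lambda>z. sprod (\<lambda>w. x \<otimes> w \<otimes> v) (\<lambda>t. e3 t + - tensor_D3 D t) z y) e3 u a =
      sprod (\<lambda>z. sprod (\<lambda>w. x \<otimes> w \<otimes> v) e3 u z) (\<lambda>t. - tensor_D3 D t) a y"
    by (rule sprod_assoc) (simp_all add: op_linear_intros tensor_D3_eq operator_simps)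
  moreover have "(\<lambda>t. e3 t + - tensor_D3 D t) = (\<lambda>t. - e1 t - e2 t)"
    by (simp add: tensor_D3_eq)
  ultimately show ?thesis
    by (simp add: tensor_map_coboundary_elem tensor_assoc_map_coboundary_elem
      left_act_bullet_summand right_act_bullet_summand)
qed

lemma coassoc_coboundary:
  assumes "bullet D lprod r \<in> range (tensor_D3 D)"
  shows "tensor_map id (coboundary D lprod r) (coboundary D lprod r a) =
    tensor_assoc (tensor_map (coboundary D lprod r) id (coboundary D lprod r a))"
proof -
  note L = op_linear_intros linear_coboundary_right linear_compose[OF linear_coboundary_right]
  obtain I :: "('a \<times> 'a) set" and c where "finite I" and "r = (\<Sum>(x, y)\<in>I. (c (x, y) *\<^sub>C x) \<otimes> y)"
    using tensor_is_sum by blast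
  define x y where "x = (\<lambda>i. c i *\<^sub>C fst i)" and "y = (snd :: 'a \<times> 'a \<Rightarrow> 'a)"
  have r: "r = (\<Sum>i\<in>I. x i \<otimes> y i)"
    by (simp add: \<open>r = _\<close> x_def y_def case_prod_beta)
  let ?c = "\<lambda>i. coboundary D lprod (x i \<otimes> y i)"
  have c: "coboundary D lprod r = (\<lambda>a. \<Sum>i\<in>I. ?c i a)"
    by (simp add: fun_eq_iff r complex_linear_sum[OF linear_coboundary[OF linear_ident]])
  have right: "tensor_map id (coboundary D lprod r) t = (\<Sum>i\<in>I. tensor_map id (?c i) t)" for t :: "'a \<otimes> 'a"
    by (rule tensor_eqI[where t = t])
      (simp_all add: L tensor_map_elem complex_linear_sum[OF linear_elem_right[OF linear_ident]] c)
  have left: "tensor_map (coboundary D lprod r) id t = (\<Sum>i\<in>I. tensor_map (?c i) id t)" for t :: "'a \<otimes> 'a"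
    by (rule tensor_eqI[where t = t])
      (simp_all add: L tensor_map_elem complex_linear_sum[OF linear_elem_left[OF linear_ident]] c)
  have "tensor_map id (coboundary D lprod r) (coboundary D lprod r a) =
      (\<Sum>i\<in>I. tensor_map id (coboundary D lprod r) (?c i a))"
    by (simp add: c complex_linear_sum[OF complex_linear_tensor_map])
  also have "\<dots> = (\<Sum>i\<in>I. \<Sum>j\<in>I. tensor_map id (?c j) (?c i a))"
    by (simp add: right)
  finally have R: "tensor_map id (coboundary D lprod r) (coboundary D lprod r a) =
      (\<Sum>i\<in>I. \<Sum>j\<in>I. tensor_map id (?c j) (?c i a))" .
  \<comment> \<open>Index \<open>i\<close> now belongs to the map applied last, whereas in
    \<open>R\<close> it belongs to the one applied first; this is the pairing that
    \<open>coassoc_defect_elem\<close> requires.\<close>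
  have "tensor_assoc (tensor_map (coboundary D lprod r) id (coboundary D lprod r a)) =
      (\<Sum>i\<in>I. tensor_assoc (tensor_map (?c i) id (coboundary D lprod r a)))"
    by (simp add: left complex_linear_sum[OF linear_tensor_assoc[OF linear_ident]])
  also have "\<dots> = (\<Sum>i\<in>I. \<Sum>j\<in>I. tensor_assoc (tensor_map (?c i) id (?c j a)))"
    by (simp add: c complex_linear_sum[OF linear_tensor_assoc[OF complex_linear_tensor_map]])
  finally have "tensor_map id (coboundary D lprod r) (coboundary D lprod r a) -
      tensor_assoc (tensor_map (coboundary D lprod r) id (coboundary D lprod r a)) =
      (\<Sum>i\<in>I. \<Sum>j\<in>I. left_act a (bullet_summand D lprod (x i) (y i) (x j) (y j)) -
        right_act a (bullet_summand D lprod (x i) (y i) (x j) (y j)))"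
    by (simp add: R sum_subtractf[symmetric] coassoc_defect_elem)
  also have "\<dots> = left_act a (bullet D lprod r) - right_act a (bullet D lprod r)"
    by (simp add: r bullet_sum sum_subtractf complex_linear_sum[OF linear_left_act[OF linear_ident]]
      complex_linear_sum[OF linear_right_act[OF linear_ident]])
  also have "\<dots> = 0"
    using assms by (auto simp: left_act_tensor_D3 right_act_tensor_D3)
  finally show ?thesis by simp
qed

section \<open>Compatibility with the product\<close>

lemma map_poly_neg_shift_subst:
  assumes f: "complex_linear f" "\<And>v. f (D v) = d (f v)" and d: "complex_linear d"
  shows "map_poly f (neg_shift_subst D p) =
    op_subst (\<lambda>w. - poly_shift w - map_poly d w) (map_poly (\<lambda>v. [:f v:]) p)"
  unfolding map_poly_as_op_subst[OF f(1)]
  by (rule op_subst_neg_shift_subst)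
    (simp_all add: op_linear_intros linear_poly_shift linear_ident f d map_poly_const map_poly_shift)

text \<open>The two sign changes undo each other: nu = -lambda - d1 - d2 put into -nu - d gives
  lambda + d1 + d2 - d, so only the derivation of the other slot survives.\<close>

lemma neg_shift_subst_map_poly_neg_shift_subst:
  fixes f :: "'a \<Rightarrow> 'a \<otimes> 'a"
  assumes f: "complex_linear f" "\<And>v. f (D v) = d (f v)" and d: "complex_linear d"
    and c: "\<And>w. d1 (d w) = d (d1 w)" "\<And>w. d2 (d w) = d (d2 w)"
  shows "neg_shift_subst (tensor_D2 D) (map_poly f (neg_shift_subst D p)) =
    op_subst (\<lambda>w. poly_shift w + map_poly d1 w + map_poly d2 w - map_poly d w) (map_poly (\<lambda>v. [:f v:]) p)"
proof -
  let ?T = "\<lambda>q. - poly_shift q - map_poly (tensor_D2 D) q"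
  have T: "complex_linear ?T" by (intro op_linear_intros linear_poly_shift)
  have md: "complex_linear (map_poly d)" by (rule complex_linear_map_poly[OF d])
  have "map_poly d1 (map_poly d q) = map_poly d (map_poly d1 q)"
    "map_poly d2 (map_poly d q) = map_poly d (map_poly d2 q)" for q
    by (simp_all add: map_poly_compose operator_linear d c)
  then have Td: "?T (map_poly d w) = map_poly d (?T w)" for w
    by (simp add: map_poly_tensor_D2 complex_linear_diff[OF md] complex_linear_minus[OF md]
      complex_linear_add[OF md] map_poly_shift d)
  have D2: "complex_linear (tensor_D2 D)" by (rule linear_tensor_D2[OF linear_ident])
  have "neg_shift_subst (tensor_D2 D) (map_poly f (neg_shift_subst D p)) =
      op_subst (\<lambda>w. - ?T w - map_poly d w) (map_poly (\<lambda>v. [:f v:]) p)"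
    unfolding neg_shift_subst_as_op_subst[OF D2 f(1)]
    by (rule op_subst_neg_shift_subst)
      (simp_all add: T Td md linear_D linear_const_poly f map_poly_const d)
  also have "(\<lambda>w. - ?T w - map_poly d w) =
      (\<lambda>w. poly_shift w + map_poly d1 w + map_poly d2 w - map_poly d w)"
    by (simp add: fun_eq_iff map_poly_tensor_D2)
  finally show ?thesis .
qed

text \<open>The multiplications in the compatibility conditions, at \<open>\<lambda>\<close> or \<open>-\<lambda>-\<partial>\<^sup>\<otimes>\<^sup>2\<close> as they occur there. The
  digit is the tensor factor multiplied, counted before the swap.\<close>

definition left2 :: "'a \<Rightarrow> 'a \<otimes> 'a \<Rightarrow> ('a \<otimes> 'a) poly"
  where "left2 a t = tensor_poly_right (lprod a) t"

definition right1 :: "'a \<Rightarrow> 'a \<otimes> 'a \<Rightarrow> ('a \<otimes> 'a) poly"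
  where "right1 a t = neg_shift_subst (tensor_D2 D) (tensor_poly_left (right_mult D lprod a) t)"

definition left1 :: "'a \<Rightarrow> 'a \<otimes> 'a \<Rightarrow> ('a \<otimes> 'a) poly"
  where "left1 a t = neg_shift_subst (tensor_D2 D) (tensor_poly_left (lprod a) t)"

definition right2 :: "'a \<Rightarrow> 'a \<otimes> 'a \<Rightarrow> ('a \<otimes> 'a) poly"
  where "right2 a t = neg_shift_subst (tensor_D2 D) (tensor_poly_right (right_mult D lprod a) t)"

definition swap_left1 :: "'a \<Rightarrow> 'a \<otimes> 'a \<Rightarrow> ('a \<otimes> 'a) poly"
  where "swap_left1 a t = map_poly tensor_swap (tensor_poly_left (lprod a) t)"

definition swap_right2 :: "'a \<Rightarrow> 'a \<otimes> 'a \<Rightarrow> ('a \<otimes> 'a) poly"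
  where "swap_right2 a t = map_poly tensor_swap (tensor_poly_right (right_mult D lprod a) t)"

lemma linear_multiplications:
  "complex_linear (left2 a)"
  "complex_linear (right1 a)"
  "complex_linear (left1 a)"
  "complex_linear (right2 a)"
  "complex_linear (swap_left1 a)"
  "complex_linear (swap_right2 a)"
  unfolding left2_def[abs_def] right1_def[abs_def] left1_def[abs_def] right2_def[abs_def]
    swap_left1_def[abs_def] swap_right2_def[abs_def]
  by (intro op_linear_intros)+

lemma left2_elem:
  "left2 a (x \<otimes> y) = sprod (\<lambda>w. [:x \<otimes> w:]) poly_shift a y"
  unfolding left2_def sprod_def tensor_poly_right_elem[OF linear_lprod]
  by (rule map_poly_as_op_subst) (intro linear_intros)

lemma right1_elem:
  "right1 a (x \<otimes> y) = sprod (\<lambda>w. [:w \<otimes> y:]) (\<lambda>w. map_poly d2 w + poly_shift w) x a"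
proof -
  have "neg_shift_subst (tensor_D2 D) (map_poly (\<lambda>z. z \<otimes> y) (neg_shift_subst D (lprod x a))) =
      op_subst (\<lambda>w. poly_shift w + map_poly d1 w + map_poly d2 w - map_poly d1 w)
        (map_poly (\<lambda>w. [:w \<otimes> y:]) (lprod x a))"
    by (rule neg_shift_subst_map_poly_neg_shift_subst)
      (simp_all add: op_linear_intros operator_elem operator_simps)
  then show ?thesis
    by (simp add: right1_def sprod_def tensor_poly_left_elem[OF linear_right_mult] right_mult_def
      add.commute)
qed

lemma left1_elem:
  "left1 a (x \<otimes> y) = sprod (\<lambda>w. [:w \<otimes> y:]) (\<lambda>w. - poly_shift w - map_poly d1 w - map_poly d2 w) a x"
proof -
  have "neg_shift_subst (tensor_D2 D) (map_poly (\<lambda>z. z \<otimes> y) (lprod a x)) =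
      op_subst (\<lambda>w. - poly_shift w - map_poly (tensor_D2 D) w) (map_poly (\<lambda>w. [:w \<otimes> y:]) (lprod a x))"
    by (intro neg_shift_subst_as_op_subst linear_intros)
  then show ?thesis
    by (simp add: left1_def sprod_def tensor_poly_left_elem[OF linear_lprod] map_poly_tensor_D2
      diff_diff_eq)
qed

lemma right2_elem:
  "right2 a (x \<otimes> y) = sprod (\<lambda>w. [:x \<otimes> w:]) (\<lambda>w. map_poly d1 w + poly_shift w) y a"
proof -
  have "neg_shift_subst (tensor_D2 D) (map_poly (\<lambda>z. x \<otimes> z) (neg_shift_subst D (lprod y a))) =
      op_subst (\<lambda>w. poly_shift w + map_poly d1 w + map_poly d2 w - map_poly d2 w)
        (map_poly (\<lambda>w. [:x \<otimes> w:]) (lprod y a))"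
    by (rule neg_shift_subst_map_poly_neg_shift_subst)
      (simp_all add: op_linear_intros operator_elem operator_simps)
  then show ?thesis
    by (simp add: right2_def sprod_def tensor_poly_right_elem[OF linear_right_mult] right_mult_def
      add.commute)
qed

lemma swap_left1_elem:
  "swap_left1 a (x \<otimes> y) = sprod (\<lambda>w. [:y \<otimes> w:]) poly_shift a x"
proof -
  have "map_poly tensor_swap (map_poly (\<lambda>z. z \<otimes> y) (lprod a x)) = map_poly (\<lambda>z. y \<otimes> z) (lprod a x)"
    by (subst map_poly_compose) (simp_all add: linear_intros linear_tensor_swap[OF linear_ident] tensor_swap_elem)
  also have "\<dots> = op_subst poly_shift (map_poly (\<lambda>w. [:y \<otimes> w:]) (lprod a x))"
    by (rule map_poly_as_op_subst) (intro linear_intros)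
  finally show ?thesis
    by (simp add: swap_left1_def sprod_def tensor_poly_left_elem[OF linear_lprod])
qed

lemma swap_right2_elem:
  "swap_right2 a (x \<otimes> y) = sprod (\<lambda>w. [:w \<otimes> x:]) (\<lambda>w. - poly_shift w - map_poly d1 w) y a"
proof -
  let ?p = "neg_shift_subst D (lprod y a)"
  have "map_poly tensor_swap (map_poly (\<lambda>z. x \<otimes> z) ?p) = map_poly (\<lambda>z. z \<otimes> x) ?p"
    by (subst map_poly_compose) (simp_all add: linear_intros linear_tensor_swap[OF linear_ident] tensor_swap_elem)
  also have "\<dots> = op_subst (\<lambda>w. - poly_shift w - map_poly d1 w) (map_poly (\<lambda>w. [:w \<otimes> x:]) (lprod y a))"
    by (rule map_poly_neg_shift_subst) (simp_all add: op_linear_intros operator_elem)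
  finally show ?thesis
    by (simp add: swap_right2_def sprod_def tensor_poly_right_elem[OF linear_right_mult] right_mult_def)
qed

section \<open>Moving derivations through the multiplications\<close>

lemma left2_intertwine:
  "left2 a (d1 t) = map_poly d1 (left2 a t)"
  "left2 a (d2 t) = map_poly d2 (left2 a t) + poly_shift (left2 a t)"
proof -
  note L = op_linear_intros linear_multiplications linear_compose[OF linear_multiplications(1)]
  have "map_poly d1 (left2 a (p \<otimes> q)) = left2 a (d1 (p \<otimes> q))" for p q
    unfolding operator_elem left2_elem
    by (subst sprod_natural[where h = "map_poly d1" and T' = poly_shift])
      (simp_all add: L operator_elem operator_simps map_poly_const)
  then show "left2 a (d1 t) = map_poly d1 (left2 a t)"
    by - (rule tensor_eqI[where t = t], (intro L)+, metis)
  have "left2 a (d2 (p \<otimes> q)) = map_poly d2 (left2 a (p \<otimes> q)) + poly_shift (left2 a (p \<otimes> q))" for p q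
    unfolding operator_elem left2_elem
    by (subst sprod_D_right[where E = "map_poly d2"])
      (simp_all add: L operator_elem operator_simps map_poly_const)
  then show "left2 a (d2 t) = map_poly d2 (left2 a t) + poly_shift (left2 a t)"
    by - (rule tensor_eqI[where t = t], (intro L)+, metis)
qed

text \<open>Slot 1 is the left argument of a product at d2 + lambda. Together the two rules send d1
  + d2 to -lambda, so the operator -d1 - d2 in the coboundary becomes plain lambda; the same happens
  for \<open>left1\<close> and \<open>right2\<close>.\<close>

lemma right1_intertwine:
  "right1 a (d1 t) = - map_poly d2 (right1 a t) - poly_shift (right1 a t)"
  "right1 a (d2 t) = map_poly d2 (right1 a t)"
proof -
  note L = op_linear_intros linear_multiplications linear_compose[OF linear_multiplications(2)]
  have "right1 a (d1 (p \<otimes> q)) = - map_poly d2 (right1 a (p \<otimes> q)) - poly_shift (right1 a (p \<otimes> q))" for p q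
    unfolding operator_elem right1_elem
    by (subst sprod_D_left) (simp_all add: L operator_simps)
  then show "right1 a (d1 t) = - map_poly d2 (right1 a t) - poly_shift (right1 a t)"
    by - (rule tensor_eqI[where t = t], (intro L)+, metis)
  have "map_poly d2 (right1 a (p \<otimes> q)) = right1 a (d2 (p \<otimes> q))" for p q
    unfolding operator_elem right1_elem
    by (subst sprod_natural[where h = "map_poly d2" and T' = "\<lambda>w. map_poly d2 w + poly_shift w"])
      (simp_all add: L operator_elem operator_simps map_poly_const)
  then show "right1 a (d2 t) = map_poly d2 (right1 a t)"
    by - (rule tensor_eqI[where t = t], (intro L)+, metis)
qed

lemma left1_intertwine:
  "left1 a (d1 t) = - map_poly d2 (left1 a t) - poly_shift (left1 a t)"
  "left1 a (d2 t) = map_poly d2 (left1 a t)"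
proof -
  note L = op_linear_intros linear_multiplications linear_compose[OF linear_multiplications(3)]
  have "left1 a (d1 (p \<otimes> q)) = - map_poly d2 (left1 a (p \<otimes> q)) - poly_shift (left1 a (p \<otimes> q))" for p q
    unfolding operator_elem left1_elem
    by (subst sprod_D_right[where E = "map_poly d1"])
      (simp_all add: L operator_elem operator_simps map_poly_const)
  then show "left1 a (d1 t) = - map_poly d2 (left1 a t) - poly_shift (left1 a t)"
    by - (rule tensor_eqI[where t = t], (intro L)+, metis)
  have "map_poly d2 (left1 a (p \<otimes> q)) = left1 a (d2 (p \<otimes> q))" for p q
    unfolding operator_elem left1_elem
    by (subst sprod_natural[where h = "map_poly d2" and T' = "\<lambda>w. - poly_shift w - map_poly d1 w - map_poly d2 w"])
      (simp_all add: L operator_elem operator_simps map_poly_const)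
  then show "left1 a (d2 t) = map_poly d2 (left1 a t)"
    by - (rule tensor_eqI[where t = t], (intro L)+, metis)
qed

lemma right2_intertwine:
  "right2 a (d1 t) = map_poly d1 (right2 a t)"
  "right2 a (d2 t) = - map_poly d1 (right2 a t) - poly_shift (right2 a t)"
proof -
  note L = op_linear_intros linear_multiplications linear_compose[OF linear_multiplications(4)]
  have "map_poly d1 (right2 a (p \<otimes> q)) = right2 a (d1 (p \<otimes> q))" for p q
    unfolding operator_elem right2_elem
    by (subst sprod_natural[where h = "map_poly d1" and T' = "\<lambda>w. map_poly d1 w + poly_shift w"])
      (simp_all add: L operator_elem operator_simps map_poly_const)
  then show "right2 a (d1 t) = map_poly d1 (right2 a t)"
    by - (rule tensor_eqI[where t = t], (intro L)+, metis)
  have "right2 a (d2 (p \<otimes> q)) = - map_poly d1 (right2 a (p \<otimes> q)) - poly_shift (right2 a (p \<otimes> q))" for p q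
    unfolding operator_elem right2_elem
    by (subst sprod_D_left) (simp_all add: L operator_simps)
  then show "right2 a (d2 t) = - map_poly d1 (right2 a t) - poly_shift (right2 a t)"
    by - (rule tensor_eqI[where t = t], (intro L)+, metis)
qed

text \<open>The swap exchanges the slots, so the indices cross over. Here, for
  \<open>swap_right2\<close> and for \<open>left2\<close>, d1 + d2 is sent to d1 + d2 +
  lambda.\<close>

lemma swap_left1_intertwine:
  "swap_left1 a (d1 t) = map_poly d2 (swap_left1 a t) + poly_shift (swap_left1 a t)"
  "swap_left1 a (d2 t) = map_poly d1 (swap_left1 a t)"
proof -
  note L = op_linear_intros linear_multiplications linear_compose[OF linear_multiplications(5)]
  have "swap_left1 a (d1 (p \<otimes> q)) = map_poly d2 (swap_left1 a (p \<otimes> q)) + poly_shift (swap_left1 a (p \<otimes> q))" for p q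
    unfolding operator_elem swap_left1_elem
    by (subst sprod_D_right[where E = "map_poly d2"])
      (simp_all add: L operator_elem operator_simps map_poly_const)
  then show "swap_left1 a (d1 t) = map_poly d2 (swap_left1 a t) + poly_shift (swap_left1 a t)"
    by - (rule tensor_eqI[where t = t], (intro L)+, metis)
  have "map_poly d1 (swap_left1 a (p \<otimes> q)) = swap_left1 a (d2 (p \<otimes> q))" for p q
    unfolding operator_elem swap_left1_elem
    by (subst sprod_natural[where h = "map_poly d1" and T' = poly_shift])
      (simp_all add: L operator_elem operator_simps map_poly_const)
  then show "swap_left1 a (d2 t) = map_poly d1 (swap_left1 a t)"
    by - (rule tensor_eqI[where t = t], (intro L)+, metis)
qed

lemma swap_right2_intertwine:
  "swap_right2 a (d1 t) = map_poly d2 (swap_right2 a t)"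
  "swap_right2 a (d2 t) = map_poly d1 (swap_right2 a t) + poly_shift (swap_right2 a t)"
proof -
  note L = op_linear_intros linear_multiplications linear_compose[OF linear_multiplications(6)]
  have "map_poly d2 (swap_right2 a (p \<otimes> q)) = swap_right2 a (d1 (p \<otimes> q))" for p q
    unfolding operator_elem swap_right2_elem
    by (subst sprod_natural[where h = "map_poly d2" and T' = "\<lambda>w. - poly_shift w - map_poly d1 w"])
      (simp_all add: L operator_elem operator_simps map_poly_const)
  then show "swap_right2 a (d1 t) = map_poly d2 (swap_right2 a t)"
    by - (rule tensor_eqI[where t = t], (intro L)+, metis)
  have "swap_right2 a (d2 (p \<otimes> q)) = map_poly d1 (swap_right2 a (p \<otimes> q)) + poly_shift (swap_right2 a (p \<otimes> q))" for p q
    unfolding operator_elem swap_right2_elem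
    by (subst sprod_D_left) (simp_all add: L operator_simps)
  then show "swap_right2 a (d2 t) = map_poly d1 (swap_right2 a t) + poly_shift (swap_right2 a t)"
    by - (rule tensor_eqI[where t = t], (intro L)+, metis)
qed

section \<open>The multiplications applied to the coboundary of an elementary tensor\<close>

lemma const_coboundary_elem:
  "[:coboundary D lprod (x \<otimes> y) a:] =
    sprod (\<lambda>w. [:x \<otimes> w:]) (\<lambda>w. - map_poly d1 w - map_poly d2 w) a y
    - sprod (\<lambda>w. [:w \<otimes> y:]) (map_poly d2) x a"
proof -
  have h: "complex_linear (\<lambda>v :: 'a \<otimes> 'a. [:v:])" by (intro linear_intros)
  have "[:sprod (\<lambda>z. x \<otimes> z) (\<lambda>t. - tensor_D2 D t) a y:] =
      sprod (\<lambda>w. [:x \<otimes> w:]) (\<lambda>w. - map_poly d1 w - map_poly d2 w) a y"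
    by (rule sprod_natural[OF h])
      (simp_all add: op_linear_intros tensor_D2_eq map_poly_const operator_linear)
  moreover have "[:sprod (\<lambda>z. z \<otimes> y) d2 x a:] = sprod (\<lambda>w. [:w \<otimes> y:]) (map_poly d2) x a"
    by (rule sprod_natural[OF h]) (simp_all add: op_linear_intros map_poly_const)
  ultimately show ?thesis
    by (simp add: coboundary_elem complex_linear_diff[OF h])
qed

lemma map_poly_coboundary_elem:
  "map_poly (coboundary D lprod (x \<otimes> y)) (lprod a b) =
    sprod (\<lambda>z. sprod (\<lambda>w. [:x \<otimes> w:]) (\<lambda>w. - map_poly d1 w - map_poly d2 w) z y) poly_shift a b
    - sprod (\<lambda>z. sprod (\<lambda>w. [:w \<otimes> y:]) (map_poly d2) x z) poly_shift a b"
proof -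
  have "map_poly (coboundary D lprod (x \<otimes> y)) (lprod a b) =
      sprod (\<lambda>z. [:coboundary D lprod (x \<otimes> y) z:]) poly_shift a b"
    unfolding sprod_def by (rule map_poly_as_op_subst[OF linear_coboundary_right])
  then show ?thesis
    by (simp add: const_coboundary_elem sprod_diff op_linear_intros)
qed

lemma left2_coboundary_elem:
  "left2 a (coboundary D lprod (x \<otimes> y) b) =
    sprod (\<lambda>z. sprod (\<lambda>w. [:x \<otimes> w:]) poly_shift a z)
      (\<lambda>w. - poly_shift w - map_poly d1 w - map_poly d2 w) b y
    - sprod (\<lambda>z. sprod (\<lambda>w. [:z \<otimes> w:]) poly_shift a y)
      (\<lambda>w. map_poly d2 w + poly_shift w) x b"
proof -
  have h: "complex_linear (left2 a)" by (rule linear_multiplications)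
  have "left2 a (sprod (\<lambda>z. x \<otimes> z) (\<lambda>t. - tensor_D2 D t) b y) =
      sprod (\<lambda>z. left2 a (x \<otimes> z)) (\<lambda>w. - poly_shift w - map_poly d1 w - map_poly d2 w) b y"
    by (rule sprod_natural[OF h])
      (simp_all add: op_linear_intros tensor_D2_eq complex_linear_diff[OF h] complex_linear_minus[OF h]
        left2_intertwine)
  moreover have "left2 a (sprod (\<lambda>z. z \<otimes> y) d2 x b) =
      sprod (\<lambda>z. left2 a (z \<otimes> y)) (\<lambda>w. map_poly d2 w + poly_shift w) x b"
    by (rule sprod_natural[OF h]) (simp_all add: op_linear_intros left2_intertwine)
  ultimately show ?thesis
    by (simp add: coboundary_elem complex_linear_diff[OF h] left2_elem)
qed

lemma right1_coboundary_elem: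
  "right1 a (coboundary D lprod (x \<otimes> y) b) =
    sprod (\<lambda>z. sprod (\<lambda>w. [:w \<otimes> z:]) (\<lambda>w. map_poly d2 w + poly_shift w) x a)
      poly_shift b y
    - sprod (\<lambda>z. sprod (\<lambda>w. [:w \<otimes> y:]) (\<lambda>w. map_poly d2 w + poly_shift w) z a)
      (map_poly d2) x b"
proof -
  have h: "complex_linear (right1 a)" by (rule linear_multiplications)
  have "right1 a (sprod (\<lambda>z. x \<otimes> z) (\<lambda>t. - tensor_D2 D t) b y) =
      sprod (\<lambda>z. right1 a (x \<otimes> z)) poly_shift b y"
    by (rule sprod_natural[OF h])
      (simp_all add: op_linear_intros tensor_D2_eq complex_linear_diff[OF h] complex_linear_minus[OF h]
        right1_intertwine)
  moreover have "right1 a (sprod (\<lambda>z. z \<otimes> y) d2 x b) =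
      sprod (\<lambda>z. right1 a (z \<otimes> y)) (map_poly d2) x b"
    by (rule sprod_natural[OF h]) (simp_all add: op_linear_intros right1_intertwine)
  ultimately show ?thesis
    by (simp add: coboundary_elem complex_linear_diff[OF h] right1_elem)
qed

lemma left1_coboundary_elem:
  "left1 a (coboundary D lprod (x \<otimes> y) b) =
    sprod (\<lambda>z. sprod (\<lambda>w. [:w \<otimes> z:]) (\<lambda>w. - poly_shift w - map_poly d1 w - map_poly d2 w) a x)
      poly_shift b y
    - sprod (\<lambda>z. sprod (\<lambda>w. [:w \<otimes> y:]) (\<lambda>w. - poly_shift w - map_poly d1 w - map_poly d2 w) a z)
      (map_poly d2) x b"
proof -
  have h: "complex_linear (left1 a)" by (rule linear_multiplications)
  have "left1 a (sprod (\<lambda>z. x \<otimes> z) (\<lambda>t. - tensor_D2 D t) b y) =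
      sprod (\<lambda>z. left1 a (x \<otimes> z)) poly_shift b y"
    by (rule sprod_natural[OF h])
      (simp_all add: op_linear_intros tensor_D2_eq complex_linear_diff[OF h] complex_linear_minus[OF h]
        left1_intertwine)
  moreover have "left1 a (sprod (\<lambda>z. z \<otimes> y) d2 x b) =
      sprod (\<lambda>z. left1 a (z \<otimes> y)) (map_poly d2) x b"
    by (rule sprod_natural[OF h]) (simp_all add: op_linear_intros left1_intertwine)
  ultimately show ?thesis
    by (simp add: coboundary_elem complex_linear_diff[OF h] left1_elem)
qed

lemma right2_coboundary_elem:
  "right2 a (coboundary D lprod (x \<otimes> y) b) =
    sprod (\<lambda>z. sprod (\<lambda>w. [:x \<otimes> w:]) (\<lambda>w. map_poly d1 w + poly_shift w) z a)
      poly_shift b y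
    - sprod (\<lambda>z. sprod (\<lambda>w. [:z \<otimes> w:]) (\<lambda>w. map_poly d1 w + poly_shift w) y a)
      (\<lambda>w. - poly_shift w - map_poly d1 w) x b"
proof -
  have h: "complex_linear (right2 a)" by (rule linear_multiplications)
  have "right2 a (sprod (\<lambda>z. x \<otimes> z) (\<lambda>t. - tensor_D2 D t) b y) =
      sprod (\<lambda>z. right2 a (x \<otimes> z)) poly_shift b y"
    by (rule sprod_natural[OF h])
      (simp_all add: op_linear_intros tensor_D2_eq complex_linear_diff[OF h] complex_linear_minus[OF h]
        right2_intertwine)
  moreover have "right2 a (sprod (\<lambda>z. z \<otimes> y) d2 x b) =
      sprod (\<lambda>z. right2 a (z \<otimes> y)) (\<lambda>w. - poly_shift w - map_poly d1 w) x b"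
    by (rule sprod_natural[OF h]) (simp_all add: op_linear_intros right2_intertwine)
  ultimately show ?thesis
    by (simp add: coboundary_elem complex_linear_diff[OF h] right2_elem)
qed

lemma swap_left1_coboundary_elem:
  "swap_left1 a (coboundary D lprod (x \<otimes> y) b) =
    sprod (\<lambda>z. sprod (\<lambda>w. [:z \<otimes> w:]) poly_shift a x)
      (\<lambda>w. - poly_shift w - map_poly d1 w - map_poly d2 w) b y
    - sprod (\<lambda>z. sprod (\<lambda>w. [:y \<otimes> w:]) poly_shift a z)
      (map_poly d1) x b"
proof -
  have h: "complex_linear (swap_left1 a)" by (rule linear_multiplications)
  have "swap_left1 a (sprod (\<lambda>z. x \<otimes> z) (\<lambda>t. - tensor_D2 D t) b y) =
      sprod (\<lambda>z. swap_left1 a (x \<otimes> z)) (\<lambda>w. - poly_shift w - map_poly d1 w - map_poly d2 w) b y"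
    by (rule sprod_natural[OF h])
      (simp_all add: op_linear_intros tensor_D2_eq complex_linear_diff[OF h] complex_linear_minus[OF h]
        swap_left1_intertwine)
  moreover have "swap_left1 a (sprod (\<lambda>z. z \<otimes> y) d2 x b) =
      sprod (\<lambda>z. swap_left1 a (z \<otimes> y)) (map_poly d1) x b"
    by (rule sprod_natural[OF h]) (simp_all add: op_linear_intros swap_left1_intertwine)
  ultimately show ?thesis
    by (simp add: coboundary_elem complex_linear_diff[OF h] swap_left1_elem)
qed

lemma swap_right2_coboundary_elem:
  "swap_right2 a (coboundary D lprod (x \<otimes> y) b) =
    sprod (\<lambda>z. sprod (\<lambda>w. [:w \<otimes> x:]) (\<lambda>w. - poly_shift w - map_poly d1 w) z a)
      (\<lambda>w. - poly_shift w - map_poly d1 w - map_poly d2 w) b y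
    - sprod (\<lambda>z. sprod (\<lambda>w. [:w \<otimes> z:]) (\<lambda>w. - poly_shift w - map_poly d1 w) y a)
      (\<lambda>w. map_poly d1 w + poly_shift w) x b"
proof -
  have h: "complex_linear (swap_right2 a)" by (rule linear_multiplications)
  have "swap_right2 a (sprod (\<lambda>z. x \<otimes> z) (\<lambda>t. - tensor_D2 D t) b y) =
      sprod (\<lambda>z. swap_right2 a (x \<otimes> z)) (\<lambda>w. - poly_shift w - map_poly d1 w - map_poly d2 w) b y"
    by (rule sprod_natural[OF h])
      (simp_all add: op_linear_intros tensor_D2_eq complex_linear_diff[OF h] complex_linear_minus[OF h]
        swap_right2_intertwine)
  moreover have "swap_right2 a (sprod (\<lambda>z. z \<otimes> y) d2 x b) =
      sprod (\<lambda>z. swap_right2 a (z \<otimes> y)) (\<lambda>w. map_poly d1 w + poly_shift w) x b"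
    by (rule sprod_natural[OF h]) (simp_all add: op_linear_intros swap_right2_intertwine)
  ultimately show ?thesis
    by (simp add: coboundary_elem complex_linear_diff[OF h] swap_right2_elem)
qed

text \<open>Terms with \<open>a\<close> and \<open>b\<close> multiplied into different slots occur
  once in each summand on the right and cancel. The remaining two are x tensor (ab)y and x(ab)
  tensor y after one associativity step each.\<close>

lemma coboundary_lprod:
  "map_poly (coboundary D lprod r) (lprod a b) =
    left2 a (coboundary D lprod r b) + right1 b (coboundary D lprod r a)"
proof -
  note L = op_linear_intros
  let ?S = "poly_shift :: ('a \<otimes> 'a) poly \<Rightarrow> _" and ?M = "\<lambda>w. map_poly d2 w + poly_shift w"
  let ?V = "\<lambda>w. - poly_shift w - map_poly d1 w - map_poly d2 w"
  have elem: "map_poly (coboundary D lprod (x \<otimes> y)) (lprod a b) =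
      left2 a (coboundary D lprod (x \<otimes> y) b) + right1 b (coboundary D lprod (x \<otimes> y) a)" for x y
  proof -
    have "sprod (\<lambda>z. sprod (\<lambda>w. [:x \<otimes> w:]) (\<lambda>w. ?S w + ?V w) z y) ?S a b =
        sprod (\<lambda>z. sprod (\<lambda>w. [:x \<otimes> w:]) ?S a z) ?V b y"
      by (rule sprod_assoc) (simp_all add: L operator_simps)
    moreover have "(\<lambda>w. ?S w + ?V w) = (\<lambda>w. - map_poly d1 w - map_poly d2 w)"
      by (simp add: fun_eq_iff)
    moreover have "sprod (\<lambda>z. sprod (\<lambda>w. [:z \<otimes> w:]) ?S a y) ?M x b =
        sprod (\<lambda>z. sprod (\<lambda>w. [:w \<otimes> z:]) ?M x b) ?S a y"
      by (rule sprod_swap) (simp_all add: L operator_simps)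
    moreover have "sprod (\<lambda>z. sprod (\<lambda>w. [:w \<otimes> y:]) ?M z b) (map_poly d2) x a =
        sprod (\<lambda>z. sprod (\<lambda>w. [:w \<otimes> y:]) (map_poly d2) x z) ?S a b"
      by (rule sprod_assoc) (simp_all add: L operator_simps)
    ultimately show ?thesis
      by (simp add: map_poly_coboundary_elem left2_coboundary_elem right1_coboundary_elem)
  qed
  \<comment> \<open>\<open>r\<close> sits inside the map applied to the coefficients, so additivity
    in \<open>r\<close> is checked coefficientwise.\<close>
  have "map_poly (coboundary D lprod (s + t)) p =
      map_poly (coboundary D lprod s) p + map_poly (coboundary D lprod t) p" for s t p
    by (rule poly_eqI) (simp add: coeff_map_poly complex_linear_0[OF linear_coboundary_right]
      complex_linear_add[OF linear_coboundary[OF linear_ident]])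
  moreover have "map_poly (coboundary D lprod 0) p = 0" for p
    by (rule poly_eqI) (simp add: coeff_map_poly complex_linear_0[OF linear_coboundary_right]
      complex_linear_0[OF linear_coboundary[OF linear_ident]])
  ultimately show ?thesis
    by (induction r rule: tensor_induct)
      (simp_all add: elem complex_linear_0[OF linear_coboundary[OF linear_ident]]
        complex_linear_add[OF linear_coboundary[OF linear_ident]]
        linear_multiplications[THEN complex_linear_0] linear_multiplications[THEN complex_linear_add])
qed

text \<open>For \<open>x \<otimes> y\<close> both sides expand to bx tensor ay - b(xa) tensor y - x
  tensor (ay)b + xa tensor yb. The two outer terms agree by interchanging evaluations, the two inner
  ones by associativity.\<close>

lemma coboundary_swap:
  "left1 b (coboundary D lprod t a) - right2 b (coboundary D lprod t a) =
    swap_left1 a (coboundary D lprod (tensor_swap t) b) - swap_right2 a (coboundary D lprod (tensor_swap t) b)"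
proof -
  note L = op_linear_intros
  let ?S = "poly_shift :: ('a \<otimes> 'a) poly \<Rightarrow> _"
  let ?U = "\<lambda>w. - poly_shift w - map_poly d1 w" and ?M = "\<lambda>w. map_poly d1 w + poly_shift w"
  let ?V = "\<lambda>w. - poly_shift w - map_poly d1 w - map_poly d2 w"
  have elem: "left1 b (coboundary D lprod (x \<otimes> y) a) - right2 b (coboundary D lprod (x \<otimes> y) a) =
      swap_left1 a (coboundary D lprod (y \<otimes> x) b) - swap_right2 a (coboundary D lprod (y \<otimes> x) b)" for x y
  proof -
    have "sprod (\<lambda>z. sprod (\<lambda>w. [:z \<otimes> w:]) ?S a y) ?V b x =
        sprod (\<lambda>z. sprod (\<lambda>w. [:w \<otimes> z:]) ?V b x) ?S a y"
      by (rule sprod_swap) (simp_all add: L operator_simps)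
    moreover have "sprod (\<lambda>z. sprod (\<lambda>w. [:w \<otimes> y:]) (\<lambda>w. ?V w + map_poly d2 w) z a) ?V b x =
        sprod (\<lambda>z. sprod (\<lambda>w. [:w \<otimes> y:]) ?V b z) (map_poly d2) x a"
      by (rule sprod_assoc) (simp_all add: L operator_simps)
    moreover have "(\<lambda>w. ?V w + map_poly d2 w) = ?U"
      by (simp add: fun_eq_iff)
    moreover have "sprod (\<lambda>z. sprod (\<lambda>w. [:x \<otimes> w:]) (\<lambda>w. ?S w + map_poly d1 w) z b) ?S a y =
        sprod (\<lambda>z. sprod (\<lambda>w. [:x \<otimes> w:]) ?S a z) (map_poly d1) y b"
      by (rule sprod_assoc) (simp_all add: L operator_simps)
    moreover have "(\<lambda>w. ?S w + map_poly d1 w) = ?M"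
      by (simp add: fun_eq_iff add.commute)
    moreover have "sprod (\<lambda>z. sprod (\<lambda>w. [:z \<otimes> w:]) ?M y b) ?U x a =
        sprod (\<lambda>z. sprod (\<lambda>w. [:w \<otimes> z:]) ?U x a) ?M y b"
      by (rule sprod_swap) (simp_all add: L operator_simps)
    ultimately show ?thesis
      by (simp add: left1_coboundary_elem right2_coboundary_elem swap_left1_coboundary_elem
        swap_right2_coboundary_elem)
  qed
  note linears = linear_diff linear_coboundary linear_tensor_swap linear_ident
    linear_multiplications[THEN linear_compose]
  show ?thesis
    by (rule tensor_eqI[where t = t], (intro linears)+) (simp only: tensor_swap_elem elem)
qed

lemma coboundary_antisym:
  assumes "tensor_swap r = - r"
  shows "left1 b (coboundary D lprod r a) - right2 b (coboundary D lprod r a) +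
    (swap_left1 a (coboundary D lprod r b) - swap_right2 a (coboundary D lprod r b)) = 0"
  unfolding coboundary_swap assms
  by (simp add: complex_linear_minus[OF linear_coboundary[OF linear_ident]]
    linear_multiplications[THEN complex_linear_minus])

end

theorem corollary5p4:
  fixes D :: "'a::complex_vector \<Rightarrow> 'a"
    and lprod :: "'a \<Rightarrow> 'a \<Rightarrow> 'a poly"
    and r :: "'a \<otimes> 'a"
  assumes "assoc_conformal_algebra D lprod"
    and "tensor_swap r = - r"
    and "bullet D lprod r \<in> range (tensor_D3 D)"
  shows "assoc_conformal_coalgebra D (coboundary D lprod r) \<and>
    asi_conformal_bialgebra D lprod (coboundary D lprod r)"
proof -
  interpret assoc_conformal_algebra D lprod by fact
  \<comment> \<open>The bialgebra axiom applies the swap to a difference, while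
    \<open>swap_left1\<close> and \<open>swap_right2\<close> treat its two parts separately.\<close>
  have swap: "complex_linear (map_poly tensor_swap :: ('a \<otimes> 'a) poly \<Rightarrow> ('a \<otimes> 'a) poly)"
    by (rule complex_linear_map_poly[OF linear_tensor_swap[OF linear_ident]])
  have coalgebra: "assoc_conformal_coalgebra D (coboundary D lprod r)"
    by (intro assoc_conformal_coalgebra.intro) (rule linear_D linear_coboundary_right coboundary_D coassoc_coboundary[OF assms(3)])+
  moreover have "asi_conformal_bialgebra D lprod (coboundary D lprod r)"
  proof (intro asi_conformal_bialgebra.intro asi_conformal_bialgebra_axioms.intro assms(1) coalgebra)
    fix a b
    show "map_poly (coboundary D lprod r) (lprod a b) =
         tensor_poly_right (lprod a) (coboundary D lprod r b) +
         neg_shift_subst (tensor_D2 D) (tensor_poly_left (right_mult D lprod b) (coboundary D lprod r a))"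
      using coboundary_lprod[of r a b] by (simp add: left2_def right1_def)
    show "neg_shift_subst (tensor_D2 D) (tensor_poly_left (lprod b) (coboundary D lprod r a)) -
       neg_shift_subst (tensor_D2 D) (tensor_poly_right (right_mult D lprod b) (coboundary D lprod r a)) +
       map_poly tensor_swap
         (tensor_poly_left (lprod a) (coboundary D lprod r b) -
           tensor_poly_right (right_mult D lprod a) (coboundary D lprod r b)) = 0"
      using coboundary_antisym[OF assms(2), of b a]
      by (simp add: left1_def right2_def swap_left1_def swap_right2_def complex_linear_diff[OF swap])
  qed
  ultimately show ?thesis ..
qed

end
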